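(* As $n\to\infty$, the number $PSP(n)$ of PSP numbers smaller than $n$ satisfies $$PSP(n) = P(2)\frac{n}{\log n} + O\!\left(\frac{n}{\log^2 n}\right),$$ where $P(2)=\sum_{q \text{ prime}} q^{-2}$ is the prime zeta function at $2$.
   Context: A PSP number is a natural number of the form $p\cdot q^2$ where $p$ and $q$ are primes. $\log$ is the natural logarithm. *)

theory Defs
  imports "HOL-Analysis.Analysis" "HOL-Library.Landau_Symbols"
    "HOL-Computational_Algebra.Primes"
begin

text \<open>The primes \<open>p\<close> and \<open>q\<close> are not required to be distinct, so cubes of primes are PSP numbers.\<close>

definition PSP_number :: "nat \<Rightarrow> bool" where
  "PSP_number m \<longleftrightarrow> (\<exists>p q. prime p \<and> prime q \<and> m = p * q ^ 2)"

definition PSP :: "nat \<Rightarrow> nat" where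
  "PSP n = card {m. m < n \<and> PSP_number m}"

text \<open>For real \<open>s > 1\<close> the sum converges absolutely; otherwise \<open>infsum\<close> returns the
  default value \<open>0\<close>. The lemma below confirms convergence at \<open>s = 2\<close>.\<close>

definition prime_zeta :: "real \<Rightarrow> real" where
  "prime_zeta s = (\<Sum>\<^sub>\<infinity>q\<in>{q::nat. prime q}. real q powr (-s))"

lemma prime_zeta_2_summable:
  "(\<lambda>q. real q powr (-2)) summable_on {q::nat. prime q}"
proof -
  have "summable (\<lambda>q. norm (real q powr (-2)))"
    by (simp add: summable_real_powr_iff)
  then have "(\<lambda>q. real q powr (-2)) summable_on UNIV"
    by (rule norm_summable_imp_summable_on)
  then show ?thesis
    by (rule summable_on_subset_banach) simp
qed

lemma prime_zeta_2: "prime_zeta 2 = (\<Sum>\<^sub>\<infinity>q\<in>{q::nat. prime q}. 1 / real q ^ 2)"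
  unfolding prime_zeta_def
  by (rule infsum_cong) (auto simp: powr_minus_divide prime_gt_0_nat)

end

theory Submission
  imports Defs "HOL-Number_Theory.Prime_Powers" "HOL-Complex_Analysis.Complex_Analysis"
begin

text \<open>
  Since \<open>(p, q) \<mapsto> p q\<^sup>2\<close> is injective on pairs of primes, \<open>PSP(n)\<close> is the sum over primes \<open>q\<close> of the
  number of primes below \<open>n/q\<^sup>2\<close>, so the claim follows from \<open>\<pi>(x) = x/log x + O(x/log\<^sup>2 x)\<close> by
  summation over \<open>q\<close>.

  This form of the prime number theorem is obtained without a zero-free region to the left of
  \<open>Re s = 1\<close>. The function \<open>F = -\<zeta>'/\<zeta> - \<zeta>\<close> has no pole at \<open>1\<close>. The inequality
  \<open>3 + 4 cos x + cos 2x \<ge> 0\<close> together with \<open>\<zeta>(s) = O(|t|\<^sup>\<eta>)\<close> near \<open>Re s = 1\<close> bounds \<open>1/\<zeta>\<close> by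
  \<open>O(|t|\<^sup>4\<^sup>\<eta>)\<close>, whence \<open>F''(s) = O(|t|\<^sup>1\<^sup>/\<^sup>2)\<close> uniformly for \<open>1 < Re s \<le> 2\<close>. As
  \<open>F''(s) = \<Sum> (\<Lambda>(n) - 1) log\<^sup>2 n n\<^sup>-\<^sup>s\<close>, Perron's formula with the kernel \<open>1/(s(s+1))\<close> on the line
  \<open>Re s = 1 + 1/log x\<close> shows that the Cesaro sum of these coefficients is \<open>O(x\<^sup>2)\<close>. Differencing with step
  \<open>x/log x\<close> turns this into \<open>\<Sum>\<^bsub>n\<le>x\<^esub> (\<Lambda>(n) - 1) log\<^sup>2 n = O(x log x)\<close>: the factor \<open>log\<^sup>2 n\<close>, i.e. the two
  derivatives of \<open>F\<close>, provides the saving of a logarithm over the main term.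
\<close>

section \<open>Absolutely convergent Dirichlet series\<close>

text \<open>The Perron integral is estimated by absolute values alone. On Re s = 1 + 1/log x the
  factor |x^s| equals e x, so the contour is never moved to Re s = 1 and no cancellation along it is
  used; the order x^2 improves on the trivial x^2 log^2 x by exactly the weight log^2 n. The
  obstacle is absolute integrability: the kernel decays like |t|^-2, so F'' has to grow more slowly
  than |t|. Expressing F'' through \<zeta> takes three successive divisions by \<zeta>, each costing
  |t|^(4\<eta>), so \<eta> must be small. This is affordable because \<zeta> = O(|t|^\<eta>) holds
  in the strip Re s >= 1 - \<eta> for every \<eta> > 0. The unsmoothing step is Tauberian: it rests
  on the one-sided bound (\<Lambda>(n) - 1) log^2 n >= - log^2 n. What it yields for primes carries
  the weight log^3 p. Replacing that weight by log^3 x requires a Chebyshev bound for \<pi>(x),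
  which is extracted from the same weighted sum.\<close>

definition dirichlet :: "(nat \<Rightarrow> real) \<Rightarrow> complex \<Rightarrow> complex" where
  "dirichlet a s = (\<Sum>n. of_real (a n) * of_nat n powr (-s))"

text \<open>Real exponents are enough because the modulus of n^-s depends on Re s alone. Index 0
  contributes nothing to these series, since \<open>0 powr z = 0\<close>.\<close>

definition abs_conv :: "(nat \<Rightarrow> real) \<Rightarrow> bool" where
  "abs_conv a \<longleftrightarrow> (\<forall>\<sigma>>1. summable (\<lambda>n. \<bar>a n\<bar> * real n powr (-\<sigma>)))"

lemma norm_nat_powr: "norm (of_nat n powr s :: complex) = real n powr Re s"
  by (cases "n = 0") (auto simp: norm_powr_real_powr)

lemma abs_conv_summable_norm:
  assumes "abs_conv a" "Re s > 1"
  shows "summable (\<lambda>n. norm (of_real (a n) * of_nat n powr (-s) :: complex))"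
proof -
  have "norm (of_real (a n) * of_nat n powr (-s) :: complex) = \<bar>a n\<bar> * real n powr (- Re s)" for n
    by (simp add: norm_mult norm_nat_powr)
  then show ?thesis
    using assms(1)[unfolded abs_conv_def] assms(2) by presburger
qed

lemma dirichlet_sums:
  assumes "abs_conv a" "Re s > 1"
  shows "(\<lambda>n. of_real (a n) * of_nat n powr (-s)) sums dirichlet a s"
  unfolding dirichlet_def
  using abs_conv_summable_norm[OF assms] by (rule summable_sums[OF summable_norm_cancel])

lemma abs_conv_bound:
  assumes "abs_conv b" "\<And>n. \<bar>a n\<bar> \<le> \<bar>b n\<bar>"
  shows "abs_conv a"
  unfolding abs_conv_def
proof safe
  fix \<sigma> :: real assume "\<sigma> > 1"
  then have "summable (\<lambda>n. \<bar>b n\<bar> * real n powr (-\<sigma>))"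
    using assms(1) by (auto simp: abs_conv_def)
  then show "summable (\<lambda>n. \<bar>a n\<bar> * real n powr (-\<sigma>))"
    by (rule summable_comparison_test') (auto intro!: mult_right_mono assms(2))
qed

lemma abs_conv_diff:
  assumes "abs_conv a" "abs_conv b"
  shows "abs_conv (\<lambda>n. a n - b n)"
  unfolding abs_conv_def
proof safe
  fix \<sigma> :: real assume "\<sigma> > 1"
  then have "summable (\<lambda>n. \<bar>a n\<bar> * real n powr (-\<sigma>) + \<bar>b n\<bar> * real n powr (-\<sigma>))"
    using assms by (auto simp: abs_conv_def intro!: summable_add)
  then show "summable (\<lambda>n. \<bar>a n - b n\<bar> * real n powr (-\<sigma>))"
    by (rule summable_comparison_test') (auto simp flip: distrib_right intro!: mult_right_mono)
qed

lemma dirichlet_diff: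
  assumes "abs_conv a" "abs_conv b" "Re s > 1"
  shows "dirichlet (\<lambda>n. a n - b n) s = dirichlet a s - dirichlet b s"
  using sums_diff[OF dirichlet_sums[OF assms(1,3)] dirichlet_sums[OF assms(2,3)]]
  by (auto simp: dirichlet_def algebra_simps dest: sums_unique)

text \<open>Half of the distance from \<sigma> to 1 pays for the logarithm, through ln n \<le> n^e /
  e.\<close>

lemma abs_conv_mult_ln:
  assumes "abs_conv a"
  shows "abs_conv (\<lambda>n. a n * ln (real n))"
  unfolding abs_conv_def
proof safe
  fix \<sigma> :: real assume \<sigma>: "\<sigma> > 1"
  define e where "e = (\<sigma> - 1) / 2"
  have e: "e > 0" "\<sigma> - e > 1" using \<sigma> by (auto simp: e_def field_simps)
  have "summable (\<lambda>n. \<bar>a n\<bar> * real n powr (-(\<sigma> - e)) / e)"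
    using assms e by (auto simp: abs_conv_def intro!: summable_divide)
  then show "summable (\<lambda>n. \<bar>a n * ln (real n)\<bar> * real n powr (-\<sigma>))"
  proof (rule summable_comparison_test')
    fix n :: nat
    show "norm (\<bar>a n * ln (real n)\<bar> * real n powr (-\<sigma>)) \<le> \<bar>a n\<bar> * real n powr (-(\<sigma> - e)) / e"
    proof (cases "n = 0")
      case False
      have "\<bar>a n\<bar> * ln (real n) * real n powr (-\<sigma>) \<le> \<bar>a n\<bar> * (real n powr e / e) * real n powr (-\<sigma>)"
        using False e by (intro mult_right_mono mult_left_mono ln_powr_bound) auto
      also have "\<dots> = \<bar>a n\<bar> * (real n powr e * real n powr (-\<sigma>)) / e" by simp
      also have "real n powr e * real n powr (-\<sigma>) = real n powr (-(\<sigma> - e))"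
        by (simp flip: powr_add)
      finally show ?thesis using False by (auto simp: abs_mult)
    qed auto
  qed
qed

lemma abs_conv_1: "abs_conv (\<lambda>_. 1)"
  by (auto simp: abs_conv_def summable_real_powr_iff)

lemma abs_conv_ln: "abs_conv (\<lambda>n. ln (real n))"
  using abs_conv_mult_ln[OF abs_conv_1] by simp

lemma abs_conv_mangoldt: "abs_conv mangoldt"
proof (rule abs_conv_bound[OF abs_conv_ln])
  show "\<bar>mangoldt n\<bar> \<le> \<bar>ln (real n)\<bar>" for n
    using mangoldt_le[of n] by (cases "n = 0") auto
qed

lemma has_field_derivative_dirichlet:
  assumes a: "abs_conv a" and s: "Re s > 1"
  shows "(dirichlet a has_field_derivative - dirichlet (\<lambda>n. a n * ln (real n)) s) (at s)"
proof -
  define f where "f = (\<lambda>n s. of_real (a n) * of_nat n powr (-s) :: complex)"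
  define f' where "f' = (\<lambda>n s. - (of_real (a n * ln (real n)) * of_nat n powr (-s)) :: complex)"
  let ?S = "{s. Re s > 1}"
  have "\<exists>g g'. \<forall>x \<in> ?S. ((\<lambda>n. f n x) sums g x) \<and> ((\<lambda>n. f' n x) sums g' x) \<and>
      (g has_field_derivative g' x) (at x)"
  proof (rule series_and_derivative_comparison_complex)
    show "open ?S" by (simp add: open_halfspace_Re_gt)
  next
    fix n x
    show "(f n has_field_derivative f' n x) (at x)"
    proof (cases "n = 0")
      case False
      then have eq: "(of_nat n :: complex) powr (-x) = exp (- x * of_real (ln (real n)))" for x
        by (simp add: powr_def Ln_of_nat)
      show ?thesis unfolding f_def f'_def eq
        by (auto intro!: derivative_eq_intros)
    qed (auto simp: f_def f'_def)
  next
    fix x assume "x \<in> ?S"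
    \<comment> \<open>The midpoint of 1 and Re x: on the ball of radius
      \<open>Re x - \<sigma>\<close> about x every term is dominated by its value at the real point
      \<sigma>, so one majorant serves a whole neighbourhood.\<close>
    define \<sigma> where "\<sigma> = (1 + Re x) / 2"
    have \<sigma>: "\<sigma> > 1" "Re x - \<sigma> > 0" using \<open>x \<in> ?S\<close> by (auto simp: \<sigma>_def field_simps)
    have "summable (\<lambda>n. \<bar>a n\<bar> * real n powr (-\<sigma>))" using a \<sigma> by (auto simp: abs_conv_def)
    then have "summable (\<lambda>n. complex_of_real (\<bar>a n\<bar> * real n powr (-\<sigma>)))"
      by (rule summable_of_real)
    moreover have "cmod (f n y) \<le> cmod (complex_of_real (\<bar>a n\<bar> * real n powr (-\<sigma>)))"
      if y: "y \<in> ball x (Re x - \<sigma>) \<inter> ?S" for n y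
    proof -
      have "\<bar>Re (x - y)\<bar> < Re x - \<sigma>"
        using y abs_Re_le_cmod[of "x - y"] by (auto simp: dist_norm)
      then have "Re y \<ge> \<sigma>" by auto
      then have "real n powr (- Re y) \<le> real n powr (-\<sigma>)"
        by (cases "n = 0") (auto intro!: powr_mono)
      then show ?thesis
        by (auto simp: f_def norm_mult norm_nat_powr abs_mult intro!: mult_left_mono)
    qed
    ultimately show "\<exists>d h. 0 < d \<and> summable h \<and> range h \<subseteq> \<real>\<^sub>\<ge>\<^sub>0 \<and>
      (\<forall>\<^sub>F n in sequentially. \<forall>y\<in>ball x d \<inter> ?S. cmod (f n y) \<le> cmod (h n))"
      using \<sigma>
      by (intro exI[of _ "Re x - \<sigma>"] exI[of _ "\<lambda>n. complex_of_real (\<bar>a n\<bar> * real n powr (-\<sigma>))"])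
         (auto intro!: always_eventually)
  qed
  then obtain g g' where g: "\<And>x. Re x > 1 \<Longrightarrow> (\<lambda>n. f n x) sums g x"
    "\<And>x. Re x > 1 \<Longrightarrow> (\<lambda>n. f' n x) sums g' x"
    "\<And>x. Re x > 1 \<Longrightarrow> (g has_field_derivative g' x) (at x)" by auto
  have g_eq: "g x = dirichlet a x" if "Re x > 1" for x
    using g(1)[OF that] by (auto simp: dirichlet_def f_def sums_iff)
  have "(\<lambda>n. f' n s) sums - dirichlet (\<lambda>n. a n * ln (real n)) s"
    unfolding f'_def by (intro sums_minus dirichlet_sums abs_conv_mult_ln a s)
  with g(2)[OF s] have g'_eq: "g' s = - dirichlet (\<lambda>n. a n * ln (real n)) s"
    by (rule sums_unique2)
  show ?thesis
    using has_field_derivative_transform_within_open[OF g(3)[OF s] open_halfspace_Re_gt[of 1], of "dirichlet a"]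
          s g_eq g'_eq by auto
qed

lemma holomorphic_dirichlet:
  assumes "abs_conv a"
  shows "dirichlet a holomorphic_on {s. Re s > 1}"
  using has_field_derivative_dirichlet[OF assms]
  by (auto simp: holomorphic_on_open open_halfspace_Re_gt)

abbreviation zeta_series :: "complex \<Rightarrow> complex" where
  "zeta_series \<equiv> dirichlet (\<lambda>_. 1)"

text \<open>Dirichlet convolution: the divisor sums of \<open>mangoldt\<close> are logarithms.
  Absolute convergence of the double series permits grouping the pairs (m, d) by their
  product.\<close>

lemma zeta_times_mangoldt:
  assumes s: "Re s > 1"
  shows "zeta_series s * dirichlet mangoldt s = dirichlet (\<lambda>n. ln (real n)) s"
proof -
  let ?u = "\<lambda>n. of_real (1::real) * of_nat n powr (-s) :: complex"
  let ?v = "\<lambda>n. of_real (mangoldt n) * of_nat n powr (-s) :: complex"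
  have hs: "(\<lambda>n. norm (of_real (a n) * of_nat n powr (-s) :: complex)) summable_on UNIV"
           "((\<lambda>n. of_real (a n) * of_nat n powr (-s)) has_sum dirichlet a s) UNIV"
    if "abs_conv a" for a
    using abs_conv_summable_norm[OF that s] 
      norm_summable_imp_has_sum[OF abs_conv_summable_norm[OF that s] dirichlet_sums[OF that s]]
    by (auto simp: norm_summable_imp_summable_on)
  \<comment> \<open>Index 0 is dropped, where both terms vanish: every number divides 0, so the
    grouping by products would not be a bijection there.\<close>
  have S1: "(?u has_sum zeta_series s) {0<..}" "(?v has_sum dirichlet mangoldt s) {0<..}"
    using hs(2)[OF abs_conv_1] hs(2)[OF abs_conv_mangoldt]
    by (auto elim!: has_sum_cong_neutral[THEN iffD1, rotated -1])
  have A1: "(\<lambda>n. norm (?u n)) summable_on {0<..}" "(\<lambda>n. norm (?v n)) summable_on {0<..}"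
    by (rule summable_on_subset_banach[OF hs(1)[OF abs_conv_1]], simp,
        rule summable_on_subset_banach[OF hs(1)[OF abs_conv_mangoldt]], simp)
  have "((\<lambda>(m,d). ?u m * ?v d) has_sum (zeta_series s * dirichlet mangoldt s)) ({0<..} \<times> {0<..})"
  proof (rule has_sum_SigmaI)
    have "(\<lambda>x. norm (case x of (m,d) \<Rightarrow> ?u m * ?v d)) summable_on ({0<..} \<times> {0<..})"
    proof (rule summable_on_SigmaI)
      show "((\<lambda>d. norm (case (m, d) of (m,d) \<Rightarrow> ?u m * ?v d)) has_sum
               norm (?u m) * (\<Sum>\<^sub>\<infinity>d\<in>{0<..}. norm (?v d))) {0<..}" for m
        unfolding prod.case norm_mult[of "?u m"] by (intro has_sum_cmult_right has_sum_infsum A1)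
      show "(\<lambda>m. norm (?u m) * (\<Sum>\<^sub>\<infinity>d\<in>{0<..}. norm (?v d))) summable_on {0<..}"
        by (intro summable_on_cmult_left A1)
    qed auto
    then show "(\<lambda>(m,d). ?u m * ?v d) summable_on ({0<..} \<times> {0<..})"
      by (rule abs_summable_summable)
    show "((\<lambda>d. case (m, d) of (m,d) \<Rightarrow> ?u m * ?v d) has_sum ?u m * dirichlet mangoldt s) {0<..}" for m
      unfolding prod.case by (intro has_sum_cmult_right S1)
    show "((\<lambda>m. ?u m * dirichlet mangoldt s) has_sum (zeta_series s * dirichlet mangoldt s)) {0<..}"
      by (intro has_sum_cmult_left S1)
  qed
  also have "?this \<longleftrightarrow> ((\<lambda>(n,d). of_nat n powr (-s) * of_real (mangoldt d)) has_sum
      (zeta_series s * dirichlet mangoldt s)) (Sigma {0<..} (\<lambda>n. {d. d dvd n}))"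
  proof (rule has_sum_reindex_bij_witness[where i = "\<lambda>(n,d). (n div d, d)" and j = "\<lambda>(m,d). (m * d, d)"])
    fix x :: "nat \<times> nat" assume "x \<in> {0<..} \<times> {0<..}"
    then show "(case case x of (m, d) \<Rightarrow> (m * d, d) of (n, d) \<Rightarrow> of_nat n powr - s * of_real (mangoldt d))
          = (case x of (m, d) \<Rightarrow> ?u m * ?v d)"
      using powr_times_real[of "of_nat (fst x)" "of_nat (snd x)" "-s"] by (auto simp: case_prod_unfold)
  qed (auto simp: dvd_div_eq_0_iff intro!: Nat.gr0I)
  finally have *: "((\<lambda>(n,d). of_nat n powr (-s) * of_real (mangoldt d)) has_sum
      (zeta_series s * dirichlet mangoldt s)) (Sigma {0<..} (\<lambda>n. {d. d dvd n}))" .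
  have "((\<lambda>n. of_nat n powr (-s) * of_real (ln (real n))) has_sum (zeta_series s * dirichlet mangoldt s)) {0<..}"
  proof (rule has_sum_SigmaD[OF *])
    fix n :: nat assume n: "n \<in> {0<..}"
    then have "(\<Sum>d | d dvd n. mangoldt d) = ln (real n)" using mangoldt_sum[of n, where ?'a = real] by auto
    moreover have "((\<lambda>d. of_nat n powr (-s) * of_real (mangoldt d)) has_sum
        (\<Sum>d | d dvd n. of_nat n powr (-s) * of_real (mangoldt d))) {d. d dvd n}"
      using n by (intro has_sum_finite finite_divisors_nat) auto
    ultimately show "((\<lambda>d. case (n, d) of (n,d) \<Rightarrow> of_nat n powr (-s) * of_real (mangoldt d)) has_sum
       of_nat n powr (-s) * complex_of_real (ln (real n))) {d. d dvd n}"
      by (simp only: prod.case flip: sum_distrib_left of_real_sum)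
  qed
  moreover have "((\<lambda>n. of_nat n powr (-s) * of_real (ln (real n))) has_sum dirichlet (\<lambda>n. ln (real n)) s) {0<..}"
    using hs(2)[OF abs_conv_ln]
    by (auto elim!: has_sum_cong_neutral[THEN iffD1, rotated -1])
  ultimately show ?thesis by (rule has_sum_unique)
qed

section \<open>Continuation and growth of the zeta function\<close>

lemma powr_neg_le_telescope:
  fixes b :: real
  assumes "b > 0" "n \<ge> (1::nat)"
  shows "real n powr (-b - 1) \<le> 2 powr (b + 1) / b * (real n powr (-b) - real (Suc n) powr (-b))"
proof -
  have "\<exists>z>real n. z < real (Suc n) \<and>
     real (Suc n) powr (-b) - real n powr (-b) = (real (Suc n) - real n) * (-b * z powr (-b - 1))"
    using assms by (intro MVT2) (auto intro!: derivative_eq_intros)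
  then obtain z where z: "z > real n" "z < real (Suc n)"
    "real n powr (-b) - real (Suc n) powr (-b) = b * z powr (-b - 1)" by auto
  \<comment> \<open>The mean value point satisfies z < n + 1 \<le> 2 n; comparing n with 2 n instead
    of z costs the factor \<open>2 powr (b + 1)\<close>.\<close>
  have "real n powr (-b - 1) = 2 powr (b + 1) * (2 * real n) powr (-b - 1)"
    by (simp add: powr_mult powr_diff powr_add powr_minus field_simps)
  also have "(2 * real n) powr (-b - 1) \<le> z powr (-b - 1)"
    using z assms by (intro powr_mono2') auto
  finally have "real n powr (-b - 1) \<le> 2 powr (b + 1) * z powr (-b - 1)" by simp
  then show ?thesis using assms z(3) by simp
qed

lemma sum_powr_tail_le:
  fixes b :: real
  assumes "b > 0" "N \<ge> (1::nat)" "N \<le> M"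
  shows "(\<Sum>n=N..<M. real n powr (-b - 1)) \<le> 2 powr (b + 1) / b * real N powr (-b)"
proof -
  have "(\<Sum>n=N..<M. real n powr (-b - 1))
      \<le> (\<Sum>n=N..<M. 2 powr (b + 1) / b * (real n powr (-b) - real (Suc n) powr (-b)))"
    using assms by (intro sum_mono powr_neg_le_telescope) auto
  also have "\<dots> = 2 powr (b + 1) / b * (real N powr (-b) - real M powr (-b))"
    using assms(3) by (subst sum_distrib_left[symmetric], subst sum_Suc_diff'[of N M "\<lambda>n. - (real n powr (-b))", simplified, symmetric])
       (auto simp: algebra_simps)
  also have "\<dots> \<le> 2 powr (b + 1) / b * real N powr (-b)"
    using assms by (intro mult_left_mono) auto
  finally show ?thesis .
qed

lemma sum_powr_le:
  fixes \<eta> :: real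
  assumes "0 < \<eta>" "\<eta> < 1"
  shows "(\<Sum>k=1..N. real k powr (\<eta> - 1)) \<le> real N powr \<eta> / \<eta>"
proof (induction N)
  case (Suc N)
  have "real (Suc N) powr (\<eta> - 1) \<le> (real (Suc N) powr \<eta> - real N powr \<eta>) / \<eta>"
  proof (cases "N = 0")
    case False
    have "\<exists>z>real N. z < real (Suc N) \<and>
      real (Suc N) powr \<eta> - real N powr \<eta> = (real (Suc N) - real N) * (\<eta> * z powr (\<eta> - 1))"
      using False by (intro MVT2) (auto intro!: derivative_eq_intros)
    then obtain z where z: "z > real N" "z < real (Suc N)"
      "real (Suc N) powr \<eta> - real N powr \<eta> = \<eta> * z powr (\<eta> - 1)" by auto
    have "real (Suc N) powr (\<eta> - 1) \<le> z powr (\<eta> - 1)"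
      using z assms by (intro powr_mono2') auto
    then show ?thesis using z(3) assms by simp
  qed (use assms in \<open>auto simp: field_simps\<close>)
  then show ?case using Suc by (simp add: diff_divide_distrib)
qed auto

text \<open>This is \<open>s - 1\<close> times the Euler--Maclaurin approximation \<open>\<Sum>\<^bsub>k\<le>N\<^esub> k\<^sup>-\<^sup>s + N\<^sup>1\<^sup>-\<^sup>s/(s - 1)\<close> of
  \<open>\<zeta>(s)\<close>; the factor removes the pole, so that the limit is holomorphic on \<open>Re s > 0\<close>.\<close>

definition zeta_approx :: "nat \<Rightarrow> complex \<Rightarrow> complex" where
  "zeta_approx N s = (s - 1) * (\<Sum>k=1..N. of_nat k powr (-s)) + of_nat N powr (1 - s)"

definition pole_free_zeta :: "complex \<Rightarrow> complex" where
  "pole_free_zeta s = lim (\<lambda>N. zeta_approx N s)"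

text \<open>Division by zero gives \<open>zeta 1 = 0\<close>, so holomorphy is asserted only away
  from the pole.\<close>

definition zeta :: "complex \<Rightarrow> complex" where
  "zeta s = pole_free_zeta s / (s - 1)"

text \<open>The increment is h(N + 1) - h(N) for the auxiliary h below, whose derivative is (s - 1)
  ((N + 1)^-s - x^-s). Bounding this difference by a second mean value estimate gains the factor 1/N
  that makes the increments summable for Re s > 0.\<close>

lemma zeta_approx_step:
  assumes "N \<ge> 1" "Re s \<ge> -1"
  shows "norm (zeta_approx (Suc N) s - zeta_approx N s) \<le> norm s * norm (s - 1) * real N powr (- Re s - 1)"
proof -
  let ?S = "closed_segment (of_nat N :: complex) (of_nat (Suc N))"
  let ?c = "of_nat (Suc N) powr (-s) :: complex"
  have S: "\<exists>u. x = of_real u \<and> real N \<le> u \<and> u \<le> real (Suc N)" if "x \<in> ?S" for x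
  proof -
    have "closed_segment (of_nat N :: complex) (of_nat (Suc N)) = of_real ` closed_segment (real N) (real (Suc N))"
      using closed_segment_of_real[of "real N" "real (Suc N)"] by simp
    then show ?thesis using that by (auto simp: closed_segment_eq_real_ivl)
  qed
  have nz: "x \<notin> \<real>\<^sub>\<le>\<^sub>0" "x \<noteq> 0" if "x \<in> ?S" for x
    using S[OF that] assms(1) by auto
  have diff: "norm (?c - x powr (-s)) \<le> norm s * real N powr (- Re s - 1)" if x: "x \<in> ?S" for x
  proof -
    have "norm (?c - x powr (-s)) \<le> norm s * real N powr (- Re s - 1) * norm (of_nat (Suc N) - x)"
    proof (rule field_differentiable_bound[of ?S "\<lambda>x. x powr (-s)" "\<lambda>x. -s * x powr (-s - 1)"])
      fix z assume z: "z \<in> ?S"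
      show "((\<lambda>x. x powr (-s)) has_field_derivative -s * z powr (-s - 1)) (at z within ?S)"
        using nz[OF z] by (auto intro!: derivative_eq_intros)
      obtain u where u: "z = of_real u" "real N \<le> u" using S[OF z] by auto
      have "u powr (- Re s - 1) \<le> real N powr (- Re s - 1)"
        using u assms by (intro powr_mono2') auto
      then show "norm (-s * z powr (-s - 1)) \<le> norm s * real N powr (- Re s - 1)"
        using u assms by (auto simp: norm_mult norm_powr_real_powr intro!: mult_left_mono)
    qed (use x in auto)
    also have "\<dots> \<le> norm s * real N powr (- Re s - 1) * 1"
    proof (rule mult_left_mono)
      obtain u where u: "x = of_real u" "real N \<le> u" "u \<le> real (Suc N)" using S[OF x] by auto
      have "of_nat (Suc N) - x = of_real (real (Suc N) - u)" using u by simp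
      then show "norm (of_nat (Suc N) - x) \<le> 1" using u by (simp only: norm_of_real)
    qed auto
    finally show ?thesis by simp
  qed
  define h where "h = (\<lambda>x. (s - 1) * x * ?c + x powr (1 - s))"
  have "zeta_approx (Suc N) s - zeta_approx N s = h (of_nat (Suc N)) - h (of_nat N)"
    by (simp add: zeta_approx_def h_def algebra_simps)
  also have "norm \<dots> \<le> norm s * norm (s - 1) * real N powr (- Re s - 1) * norm (of_nat (Suc N) - of_nat N :: complex)"
  proof (rule field_differentiable_bound[of ?S h "\<lambda>x. (s - 1) * (?c - x powr (-s))"])
    fix z assume z: "z \<in> ?S"
    show "(h has_field_derivative (s - 1) * (?c - z powr (-s))) (at z within ?S)"
      using nz[OF z] unfolding h_def by (auto intro!: derivative_eq_intros simp: algebra_simps)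
    show "norm ((s - 1) * (?c - z powr (-s))) \<le> norm s * norm (s - 1) * real N powr (- Re s - 1)"
      using mult_left_mono[OF diff[OF z], of "norm (s - 1)"] by (simp add: norm_mult mult_ac)
  qed auto
  finally show ?thesis
    by simp
qed

lemma zeta_approx_diff_le:
  assumes "b > 0" "Re s \<ge> b" "N \<ge> 1" "N \<le> M"
  shows "norm (zeta_approx M s - zeta_approx N s)
           \<le> norm s * norm (s - 1) * (2 powr (b + 1) / b * real N powr (-b))"
proof -
  have "zeta_approx M s - zeta_approx N s = (\<Sum>n=N..<M. zeta_approx (Suc n) s - zeta_approx n s)"
    using sum_Suc_diff'[OF assms(4), of "\<lambda>n. zeta_approx n s"] by simp
  also have "norm \<dots> \<le> (\<Sum>n=N..<M. norm s * norm (s - 1) * real n powr (- b - 1))"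
  proof (intro order.trans[OF norm_sum] sum_mono order.trans[OF zeta_approx_step])
    fix n assume "n \<in> {N..<M}"
    then show "norm s * norm (s - 1) * real n powr (- Re s - 1) \<le> norm s * norm (s - 1) * real n powr (- b - 1)"
      using assms by (intro mult_left_mono powr_mono) auto
  qed (use assms in auto)
  also have "\<dots> \<le> norm s * norm (s - 1) * (2 powr (b + 1) / b * real N powr (-b))"
    unfolding sum_distrib_left[symmetric] using assms by (intro mult_left_mono sum_powr_tail_le) auto
  finally show ?thesis .
qed

text \<open>The limit is \<open>zeta_approx 1\<close> plus the series of increments, which is
  dominated locally uniformly by \<open>zeta_approx_step\<close> and may therefore be differentiated
  as a limit. The index shift keeps N \<ge> 1, as that bound requires.\<close>

lemma pole_free_zeta_aux:
  "\<forall>s. Re s > 0 \<longrightarrow> (\<lambda>N. zeta_approx N s) \<longlonglongrightarrow> pole_free_zeta s \<and>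
     pole_free_zeta field_differentiable at s"
proof -
  let ?S = "{s. Re s > (0::real)}"
  define f where "f = (\<lambda>n s. zeta_approx (Suc (Suc n)) s - zeta_approx (Suc n) s)"
  have hol: "zeta_approx n holomorphic_on ?S" if "n > 0" for n
    unfolding zeta_approx_def[abs_def] using that by (intro holomorphic_intros) auto
  have opn: "open ?S" by (simp add: open_halfspace_Re_gt)
  obtain g where gg: "\<forall>x \<in> ?S. ((\<lambda>n. f n x) sums g x) \<and> g field_differentiable at x"
  proof (rule series_differentiable_comparison_complex[OF opn])
    show "f n field_differentiable at x" if "x \<in> ?S" for n x
      unfolding f_def using hol that opn
      by (intro derivative_intros) (auto simp: holomorphic_on_open field_differentiable_def)
  next
    fix x assume x: "x \<in> ?S"
    define b where "b = Re x / 2"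
    have b: "b > 0" using x by (auto simp: b_def)
    define K where "K = (norm x + b) * (norm x + b + 1)"
    have K: "K \<ge> 0" using b by (auto simp: K_def)
    define h where "h = (\<lambda>n. complex_of_real (K * real (Suc n) powr (-b - 1)))"
    have "summable (\<lambda>n. real (Suc n) powr (-b - 1))"
      by (subst summable_Suc_iff) (use b in \<open>auto simp: summable_real_powr_iff\<close>)
    then have "summable h" unfolding h_def by (intro summable_of_real summable_mult)
    moreover have "norm (f n y) \<le> norm (h n)" if y: "y \<in> ball x b \<inter> ?S" for n y
    proof -
      have "\<bar>Re (x - y)\<bar> < b" "norm (y - x) < b"
        using y abs_Re_le_cmod[of "x - y"] by (auto simp: dist_norm norm_minus_commute)
      then have Re_y: "Re y \<ge> b" unfolding b_def minus_complex.sel by linarith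
      have ny: "norm y \<le> norm x + b" using \<open>norm (y - x) < b\<close> norm_triangle_sub[of y x] by linarith
      then have ny1: "norm (y - 1) \<le> norm x + b + 1" using norm_triangle_ineq4[of y 1] by simp
      have "norm (f n y) \<le> norm y * norm (y - 1) * real (Suc n) powr (- Re y - 1)"
        unfolding f_def using Re_y b by (intro zeta_approx_step) auto
      also have "\<dots> \<le> K * real (Suc n) powr (-b - 1)"
        unfolding K_def using Re_y b ny ny1 by (intro mult_mono powr_mono) auto
      finally show ?thesis using K unfolding h_def norm_of_real by (simp add: abs_mult)
    qed
    moreover have "range h \<subseteq> \<real>\<^sub>\<ge>\<^sub>0" using K by (auto simp: h_def)
    ultimately show "\<exists>d h. 0 < d \<and> summable h \<and> range h \<subseteq> \<real>\<^sub>\<ge>\<^sub>0 \<and>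
      (\<forall>\<^sub>F n in sequentially. \<forall>y\<in>ball x d \<inter> ?S. cmod (f n y) \<le> cmod (h n))"
      using b by (intro exI[of _ b] exI[of _ h]) (auto intro!: always_eventually)
  qed (rule that)
  have g: "\<And>x. Re x > 0 \<Longrightarrow> (\<lambda>n. f n x) sums g x"
    "\<And>x. Re x > 0 \<Longrightarrow> g field_differentiable at x" using gg by auto
  have lim: "(\<lambda>N. zeta_approx N x) \<longlonglongrightarrow> zeta_approx 1 x + g x" if "Re x > 0" for x
  proof -
    have "(\<lambda>n. (\<Sum>k<n. f k x)) \<longlonglongrightarrow> g x" using g(1)[OF that] by (simp add: sums_def)
    then have "(\<lambda>n. zeta_approx 1 x + (\<Sum>k<n. f k x)) \<longlonglongrightarrow> zeta_approx 1 x + g x"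
      by (intro tendsto_intros)
    also have "(\<lambda>n. zeta_approx 1 x + (\<Sum>k<n. f k x)) = (\<lambda>n. zeta_approx (Suc n) x)"
      unfolding f_def by (subst sum_lessThan_telescope) auto
    finally show ?thesis by (rule LIMSEQ_imp_Suc)
  qed
  have eq: "pole_free_zeta x = zeta_approx 1 x + g x" if "Re x > 0" for x
    unfolding pole_free_zeta_def using lim[OF that] by (rule limI)
  have "pole_free_zeta field_differentiable at x" if x: "Re x > 0" for x
  proof -
    have "(\<lambda>x. zeta_approx 1 x + g x) field_differentiable at x"
      using hol[of 1] x opn g(2)[OF x]
      by (intro derivative_intros) (auto simp: holomorphic_on_open field_differentiable_def)
    then obtain D where "((\<lambda>x. zeta_approx 1 x + g x) has_field_derivative D) (at x)"
      by (auto simp: field_differentiable_def)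
    then have "(pole_free_zeta has_field_derivative D) (at x)"
      by (rule has_field_derivative_transform_within_open[OF _ opn]) (use x eq in auto)
    then show ?thesis by (auto simp: field_differentiable_def)
  qed
  then show ?thesis using lim eq by auto
qed

lemma zeta_approx_tendsto: "Re s > 0 \<Longrightarrow> (\<lambda>N. zeta_approx N s) \<longlonglongrightarrow> pole_free_zeta s"
  using pole_free_zeta_aux by blast

lemma holomorphic_pole_free_zeta: "pole_free_zeta holomorphic_on {s. Re s > 0}"
  using pole_free_zeta_aux by (auto simp: holomorphic_on_def field_differentiable_at_within)

text \<open>This is the residue of \<zeta> at 1; the approximants are already constant from N = 1
  on.\<close>

lemma pole_free_zeta_1: "pole_free_zeta 1 = 1"
proof -
  have "(\<lambda>N. zeta_approx N 1) \<longlonglongrightarrow> 1"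
    by (rule tendsto_eventually)
       (auto simp: zeta_approx_def eventually_at_top_linorder intro!: exI[of _ 1])
  then show ?thesis unfolding pole_free_zeta_def by (rule limI)
qed

lemma zeta_eq_series:
  assumes "Re s > 1"
  shows "zeta s = zeta_series s"
proof -
  have "(\<lambda>n. (\<Sum>k<n. of_nat k powr (-s) :: complex)) \<longlonglongrightarrow> zeta_series s"
    using dirichlet_sums[OF abs_conv_1 assms] by (simp add: sums_def)
  then have "(\<lambda>n. (\<Sum>k<Suc n. of_nat k powr (-s) :: complex)) \<longlonglongrightarrow> zeta_series s"
    by (rule LIMSEQ_Suc)
  also have "(\<lambda>n. (\<Sum>k<Suc n. of_nat k powr (-s) :: complex)) = (\<lambda>n. \<Sum>k=1..n. of_nat k powr (-s))"
    by (intro ext sum.mono_neutral_right) auto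
  finally have 1: "(\<lambda>n. \<Sum>k=1..n. of_nat k powr (-s) :: complex) \<longlonglongrightarrow> zeta_series s" .
  have "(\<lambda>n. real n powr (1 - Re s)) \<longlonglongrightarrow> 0"
    using assms by (intro tendsto_neg_powr filterlim_real_sequentially) auto
  then have "(\<lambda>n. norm (of_nat n powr (1 - s) :: complex)) \<longlonglongrightarrow> 0"
    by (simp add: norm_nat_powr)
  then have 2: "(\<lambda>n. of_nat n powr (1 - s) :: complex) \<longlonglongrightarrow> 0"
    by (rule tendsto_norm_zero_cancel)
  have "(\<lambda>N. zeta_approx N s) \<longlonglongrightarrow> (s - 1) * zeta_series s + 0"
    unfolding zeta_approx_def by (intro tendsto_intros 1 2)
  then have "pole_free_zeta s = (s - 1) * zeta_series s"
    using zeta_approx_tendsto[of s] assms LIMSEQ_unique by fastforce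
  then show ?thesis using assms by (auto simp: zeta_def)
qed

text \<open>The Euler--Maclaurin formula is cut at N about |Im s|. Then |s| N^-b, the finite sum and
  the boundary term are all of order N^\<eta>; they account for \<open>4 * K\<close>,
  \<open>1 / \<eta>\<close> and \<open>1 / t0\<close> in C. The range up to Re s = 3 leaves room for
  Cauchy circles about points with Re s \<le> 2.\<close>

lemma zeta_growth:
  assumes "0 < \<eta>" "\<eta> < 1" "t0 > 0"
  obtains C where "C > 0"
    "\<And>s. 1 - \<eta> \<le> Re s \<Longrightarrow> Re s \<le> 3 \<Longrightarrow> \<bar>Im s\<bar> \<ge> t0 \<Longrightarrow> norm (zeta s) \<le> C * (1 + \<bar>Im s\<bar>) powr \<eta>"
proof
  define b where "b = 1 - \<eta>"
  define K where "K = 2 powr (b + 1) / b"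
  define C where "C = 4 * K + 1 / \<eta> + 1 / t0"
  have b: "b > 0" and K: "K > 0" using assms by (auto simp: b_def K_def)
  show C: "C > 0" unfolding C_def using K assms by (intro add_pos_pos) auto
  fix s assume s: "1 - \<eta> \<le> Re s" "Re s \<le> 3" "\<bar>Im s\<bar> \<ge> t0"
  define N where "N = nat \<lceil>\<bar>Im s\<bar>\<rceil>"
  have N: "N \<ge> 1" "\<bar>Im s\<bar> \<le> real N" "real N \<le> 1 + \<bar>Im s\<bar>"
    using s assms unfolding N_def by linarith+
  have nz: "s \<noteq> 1" using s assms by auto
  have ns: "norm s \<le> 4 * real N"
    using cmod_le[of s] s N assms by linarith
  have "norm (pole_free_zeta s - zeta_approx N s) \<le> norm s * norm (s - 1) * (K * real N powr (-b))"
  proof (rule tendsto_upperbound)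
    show "(\<lambda>M. norm (zeta_approx M s - zeta_approx N s)) \<longlonglongrightarrow> norm (pole_free_zeta s - zeta_approx N s)"
      using s assms by (intro tendsto_intros zeta_approx_tendsto) auto
    show "\<forall>\<^sub>F M in sequentially. norm (zeta_approx M s - zeta_approx N s) \<le> norm s * norm (s - 1) * (K * real N powr (-b))"
      using eventually_ge_at_top[of N] unfolding K_def
      by eventually_elim (rule zeta_approx_diff_le, use b N s in \<open>auto simp: b_def\<close>)
  qed auto
  also have "\<dots> \<le> (4 * real N) * norm (s - 1) * (K * real N powr (-b))"
    using ns K by (intro mult_right_mono) auto
  also have "\<dots> = norm (s - 1) * (4 * K * real N powr \<eta>)"
    using N by (simp add: b_def powr_diff powr_minus field_simps)
  finally have 1: "norm (pole_free_zeta s - zeta_approx N s) \<le> norm (s - 1) * (4 * K * real N powr \<eta>)" .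
  have "norm (\<Sum>k=1..N. of_nat k powr (-s) :: complex) \<le> (\<Sum>k=1..N. real k powr (\<eta> - 1))"
    using s by (intro order.trans[OF norm_sum] sum_mono) (auto simp: norm_nat_powr intro!: powr_mono)
  also have "\<dots> \<le> real N powr \<eta> / \<eta>" using assms by (intro sum_powr_le)
  finally have 2: "norm ((s - 1) * (\<Sum>k=1..N. of_nat k powr (-s))) \<le> norm (s - 1) * (real N powr \<eta> / \<eta>)"
    unfolding norm_mult by (intro mult_left_mono) auto
  have "norm (of_nat N powr (1 - s) :: complex) \<le> real N powr \<eta>"
    using N s by (auto simp: norm_nat_powr intro!: powr_mono)
  also have "\<dots> \<le> norm (s - 1) * (real N powr \<eta> / t0)"
  proof -
    have "norm (s - 1) \<ge> t0" using abs_Im_le_cmod[of "s - 1"] s by simp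
    then have "t0 * (real N powr \<eta> / t0) \<le> norm (s - 1) * (real N powr \<eta> / t0)"
      using assms by (intro mult_right_mono) auto
    then show ?thesis using assms by simp
  qed
  finally have 3: "norm (of_nat N powr (1 - s) :: complex) \<le> norm (s - 1) * (real N powr \<eta> / t0)" .
  have "norm (pole_free_zeta s) \<le> norm (pole_free_zeta s - zeta_approx N s) + norm (zeta_approx N s)"
    by norm
  also have "norm (zeta_approx N s) \<le> norm (s - 1) * (real N powr \<eta> / \<eta>) + norm (s - 1) * (real N powr \<eta> / t0)"
    unfolding zeta_approx_def by (intro order.trans[OF norm_triangle_ineq] add_mono 2 3)
  finally have "norm (pole_free_zeta s) \<le> norm (s - 1) * (C * real N powr \<eta>)"
    using 1 by (simp add: C_def algebra_simps)
  then have "norm (zeta s) \<le> C * real N powr \<eta>"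
    using nz by (simp add: zeta_def norm_divide field_simps)
  also have "\<dots> \<le> C * (1 + \<bar>Im s\<bar>) powr \<eta>"
    using C N assms by (intro mult_left_mono powr_mono2) auto
  finally show "norm (zeta s) \<le> C * (1 + \<bar>Im s\<bar>) powr \<eta>" .
qed

lemma holomorphic_zeta: "zeta holomorphic_on {s. Re s > 0} - {1}"
  unfolding zeta_def[abs_def]
  by (intro holomorphic_intros holomorphic_on_subset[OF holomorphic_pole_free_zeta]) auto

text \<open>Cauchy's inequality on a circle of radius r \<le> \<eta>, which stays in the strip of
  \<open>zeta_growth\<close>. The order 3 is the highest derivative of \<zeta> in F''; 6 is 3!, and
  the other factor 2 covers the change of |Im s| along the circle.\<close>

lemma zeta_deriv_growth:
  assumes "0 < \<eta>" "\<eta> < 1" "t0 > 0"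
  obtains C where "C > 0"
    "\<And>k s. k \<le> 3 \<Longrightarrow> 1 \<le> Re s \<Longrightarrow> Re s \<le> 2 \<Longrightarrow> \<bar>Im s\<bar> \<ge> t0 \<Longrightarrow>
       norm ((deriv ^^ k) zeta s) \<le> C * (1 + \<bar>Im s\<bar>) powr \<eta>"
proof -
  obtain C where C: "C > 0"
    "\<And>s. 1 - \<eta> \<le> Re s \<Longrightarrow> Re s \<le> 3 \<Longrightarrow> \<bar>Im s\<bar> \<ge> t0 / 2 \<Longrightarrow> norm (zeta s) \<le> C * (1 + \<bar>Im s\<bar>) powr \<eta>"
    using zeta_growth[OF assms(1,2), of "t0 / 2"] assms by auto
  define r where "r = min \<eta> (t0 / 2)"
  have r: "r > 0" "r \<le> \<eta>" "r \<le> t0 / 2" "r < 1" using assms by (auto simp: r_def)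
  show ?thesis
  proof (rule that[of "6 * (C * 2) / r ^ 3"])
    show "6 * (C * 2) / r ^ 3 > 0" using C r by auto
    fix k s assume k: "k \<le> (3::nat)" and s: "1 \<le> Re s" "Re s \<le> 2" "\<bar>Im s\<bar> \<ge> t0"
    have w: "1 - \<eta> \<le> Re w \<and> Re w \<le> 3 \<and> \<bar>Im w\<bar> \<ge> t0 / 2 \<and> \<bar>Im w\<bar> \<le> 1 + \<bar>Im s\<bar>" if "norm (s - w) \<le> r" for w
      using abs_Re_le_cmod[of "s - w"] abs_Im_le_cmod[of "s - w"] that r s unfolding minus_complex.sel by linarith
    have sub: "cball s r \<subseteq> {s. Re s > 0} - {1}"
      using w assms by (force simp: dist_norm)
    have "norm ((deriv ^^ k) zeta s) \<le> fact k * (C * 2 * (1 + \<bar>Im s\<bar>) powr \<eta>) / r ^ k"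
    proof (rule Cauchy_inequality)
      show "zeta holomorphic_on ball s r"
        by (rule holomorphic_on_subset[OF holomorphic_zeta]) (use sub ball_subset_cball in blast)
      show "continuous_on (cball s r) zeta"
        by (rule holomorphic_on_imp_continuous_on, rule holomorphic_on_subset[OF holomorphic_zeta sub])
      fix x assume "norm (s - x) = r"
      then have x: "1 - \<eta> \<le> Re x" "Re x \<le> 3" "\<bar>Im x\<bar> \<ge> t0 / 2" "\<bar>Im x\<bar> \<le> 1 + \<bar>Im s\<bar>" using w[of x] by auto
      have "norm (zeta x) \<le> C * (1 + \<bar>Im x\<bar>) powr \<eta>" by (rule C(2)) (use x in auto)
      also have "\<dots> \<le> C * (2 * (1 + \<bar>Im s\<bar>)) powr \<eta>"
        using x C assms by (intro mult_left_mono powr_mono2) auto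
      also have "\<dots> = C * (2 powr \<eta> * (1 + \<bar>Im s\<bar>) powr \<eta>)" by (subst powr_mult) auto
      also have "\<dots> \<le> C * (2 powr 1 * (1 + \<bar>Im s\<bar>) powr \<eta>)"
        using C assms by (intro mult_left_mono mult_right_mono powr_mono) auto
      finally show "norm (zeta x) \<le> C * 2 * (1 + \<bar>Im s\<bar>) powr \<eta>" by simp
    qed (use r in auto)
    also have "\<dots> \<le> 6 * (C * 2 * (1 + \<bar>Im s\<bar>) powr \<eta>) / r ^ 3"
    proof (intro frac_le mult_right_mono)
      show "(fact k :: real) \<le> 6" using fact_mono[OF k, where ?'a = real] by (simp add: eval_nat_numeral)
      show "r ^ 3 \<le> r ^ k" using r k by (intro power_decreasing) auto
    qed (use C r in auto)
    finally show "norm ((deriv ^^ k) zeta s) \<le> 6 * (C * 2) / r ^ 3 * (1 + \<bar>Im s\<bar>) powr \<eta>"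
      by (simp add: field_simps)
  qed
qed

section \<open>Lower bounds for the zeta function on \<open>Re s \<ge> 1\<close>\<close>

text \<open>Up to the sign (-1)^k, these are the k-th derivatives of \<zeta> and, for
  \<open>mangoldt_series\<close>, of -\<zeta>'/\<zeta> on Re s > 1.\<close>

abbreviation log_series :: "nat \<Rightarrow> complex \<Rightarrow> complex" where
  "log_series k \<equiv> dirichlet (\<lambda>n. ln (real n) ^ k)"

abbreviation mangoldt_series :: "nat \<Rightarrow> complex \<Rightarrow> complex" where
  "mangoldt_series k \<equiv> dirichlet (\<lambda>n. mangoldt n * ln (real n) ^ k)"

lemma abs_conv_ln_power: "abs_conv (\<lambda>n. ln (real n) ^ k)"
proof (induction k)
  case (Suc k)
  show ?case using abs_conv_mult_ln[OF Suc] by (simp add: mult.commute)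
qed (simp add: abs_conv_1)

lemma abs_conv_mangoldt_ln_power: "abs_conv (\<lambda>n. mangoldt n * ln (real n) ^ k)"
proof (induction k)
  case (Suc k)
  show ?case using abs_conv_mult_ln[OF Suc] by (simp add: mult_ac)
qed (simp add: abs_conv_mangoldt)

lemma has_field_derivative_log_series:
  assumes "Re s > 1"
  shows "(log_series k has_field_derivative - log_series (Suc k) s) (at s)"
  using has_field_derivative_dirichlet[OF abs_conv_ln_power assms, of k] by (simp add: mult.commute)

lemma has_field_derivative_mangoldt_series:
  assumes "Re s > 1"
  shows "(mangoldt_series k has_field_derivative - mangoldt_series (Suc k) s) (at s)"
  using has_field_derivative_dirichlet[OF abs_conv_mangoldt_ln_power assms, of k] by (simp add: mult_ac)

text \<open>Allows an identity between functions on Re s > 1 to be differentiated.\<close>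

lemma deriv_unique_halfplane:
  assumes "(f has_field_derivative D) (at s)" "(g has_field_derivative D') (at s)"
    "Re s > 1" "\<And>z. Re z > 1 \<Longrightarrow> f z = g z"
  shows "D = (D' :: complex)"
proof -
  have "(g has_field_derivative D) (at s)"
    by (rule has_field_derivative_transform_within_open[OF assms(1) open_halfspace_Re_gt[of 1]])
       (use assms in auto)
  then show ?thesis using assms(2) by (rule DERIV_unique)
qed

text \<open>This identity and its first two derivatives, proved next, determine each
  \<open>mangoldt_series\<close> from the preceding ones by a single division by \<zeta>, so a lower
  bound for |\<zeta>| is the only extra input for bounding them.\<close>

lemma series_identity_0:
  assumes "Re s > 1"
  shows "log_series 0 s * mangoldt_series 0 s = log_series 1 s"
  using zeta_times_mangoldt[OF assms] by simp

lemma series_identity_1: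
  assumes "Re s > 1"
  shows "log_series 1 s * mangoldt_series 0 s + log_series 0 s * mangoldt_series 1 s = log_series 2 s"
proof -
  have "((\<lambda>s. log_series 0 s * mangoldt_series 0 s) has_field_derivative
      (- log_series (Suc 0) s) * mangoldt_series 0 s + (- mangoldt_series (Suc 0) s) * log_series 0 s) (at s)"
    by (rule DERIV_mult[OF has_field_derivative_log_series has_field_derivative_mangoldt_series]) fact+
  from deriv_unique_halfplane[OF this has_field_derivative_log_series[OF assms, of 1] assms series_identity_0]
  show ?thesis by (simp add: numeral_2_eq_2 algebra_simps add_eq_0_iff)
qed

lemma series_identity_2:
  assumes "Re s > 1"
  shows "log_series 2 s * mangoldt_series 0 s + 2 * log_series 1 s * mangoldt_series 1 s
           + log_series 0 s * mangoldt_series 2 s = log_series 3 s"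
proof -
  have "((\<lambda>s. log_series 1 s * mangoldt_series 0 s + log_series 0 s * mangoldt_series 1 s) has_field_derivative
      ((- log_series (Suc 1) s) * mangoldt_series 0 s + (- mangoldt_series (Suc 0) s) * log_series 1 s) +
      ((- log_series (Suc 0) s) * mangoldt_series 1 s + (- mangoldt_series (Suc 1) s) * log_series 0 s)) (at s)"
    by (intro DERIV_add DERIV_mult has_field_derivative_log_series has_field_derivative_mangoldt_series) fact+
  from deriv_unique_halfplane[OF this has_field_derivative_log_series[OF assms, of 2] assms series_identity_1]
  show ?thesis by (simp add: numeral_2_eq_2 numeral_3_eq_3 algebra_simps add_eq_0_iff)
qed

lemma higher_deriv_zeta:
  assumes "Re s > 1"
  shows "(deriv ^^ k) zeta s = (-1) ^ k * log_series k s"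
  using assms
proof (induction k arbitrary: s)
  case (Suc k)
  have "((\<lambda>z. (-1) ^ k * log_series k z) has_field_derivative (-1) ^ k * - log_series (Suc k) s) (at s)"
    by (intro DERIV_cmult has_field_derivative_log_series) fact
  then have "((deriv ^^ k) zeta has_field_derivative (-1) ^ k * - log_series (Suc k) s) (at s)"
    by (rule has_field_derivative_transform_within_open[OF _ open_halfspace_Re_gt[of 1]]) (use Suc in auto)
  then show ?case by (simp add: DERIV_imp_deriv)
qed (simp add: zeta_eq_series)

text \<open>The series of log \<zeta>, with coefficient 1/k at p^k; it provides a logarithm without
  choosing branches. At n \<le> 1 the quotient is 0 because \<open>ln 0 = 0\<close>,
  \<open>ln 1 = 0\<close> and division by zero gives 0.\<close>

definition log_zeta :: "complex \<Rightarrow> complex" where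
  "log_zeta = dirichlet (\<lambda>n. mangoldt n / ln (real n))"

lemma abs_conv_log_zeta: "abs_conv (\<lambda>n. mangoldt n / ln (real n))"
proof (rule abs_conv_bound[OF abs_conv_1])
  show "\<bar>mangoldt n / ln (real n)\<bar> \<le> \<bar>1\<bar>" for n
    using mangoldt_le[of n] mangoldt_nonneg[of n] 
    by (cases "n \<le> 1") (auto simp: abs_div divide_le_eq le_Suc_eq)
qed

lemma has_field_derivative_log_zeta:
  assumes "Re s > 1"
  shows "(log_zeta has_field_derivative - mangoldt_series 0 s) (at s)"
proof -
  have "mangoldt n / ln (real n) * ln (real n) = mangoldt n" for n
    by (cases "n \<le> 1") (auto simp: le_Suc_eq)
  with has_field_derivative_dirichlet[OF abs_conv_log_zeta assms] show ?thesis
    by (simp add: log_zeta_def)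
qed

lemma isCont_pole_free_zeta: "Re s > 0 \<Longrightarrow> isCont pole_free_zeta s"
  using holomorphic_on_imp_continuous_on[OF holomorphic_pole_free_zeta]
  by (simp add: continuous_on_eq_continuous_at open_halfspace_Re_gt)

text \<open>The constant \<open>c\<close> is in fact \<open>1\<close>, but only \<open>c \<noteq> 0\<close> matters below.\<close>

lemma zeta_eq_exp_log_zeta:
  obtains c where "c \<noteq> 0" "\<And>s. Re s > 1 \<Longrightarrow> zeta s = c * exp (log_zeta s)"
proof -
  \<comment> \<open>By \<open>series_identity_0\<close> the logarithmic derivatives of \<zeta> and
    of exp(\<open>log_zeta\<close>) agree, so the quotient has derivative 0 on a convex set.\<close>
  have "\<exists>c. \<forall>s\<in>{s. Re s > 1}. log_series 0 s * exp (- log_zeta s) = c"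
  proof (rule has_field_derivative_zero_constant)
    show "convex {s. Re s > 1}" by (simp add: convex_halfspace_Re_gt)
    fix s assume "s \<in> {s. Re s > 1}"
    then have s: "Re s > 1" by simp
    have "((\<lambda>s. log_series 0 s * exp (- log_zeta s)) has_field_derivative
        - log_series (Suc 0) s * exp (- log_zeta s) + exp (- log_zeta s) * - (- mangoldt_series 0 s) * log_series 0 s) (at s)"
      by (intro DERIV_mult has_field_derivative_log_series s DERIV_chain2[OF DERIV_exp] DERIV_minus has_field_derivative_log_zeta)
    moreover have "- log_series (Suc 0) s * exp (- log_zeta s) + exp (- log_zeta s) * - (- mangoldt_series 0 s) * log_series 0 s = 0"
      using series_identity_0[OF s] by (simp add: algebra_simps)
    ultimately show "((\<lambda>s. log_series 0 s * exp (- log_zeta s)) has_field_derivative 0) (at s within {s. Re s > 1})"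
      by (simp only: has_field_derivative_at_within)
  qed
  then obtain c where c: "log_series 0 s * exp (- log_zeta s) = c" if "Re s > 1" for s by blast
  have eq: "zeta s = c * exp (log_zeta s)" if "Re s > 1" for s
    using c[OF that, symmetric] zeta_eq_series[OF that] by (simp add: exp_minus)
  have "c \<noteq> 0"
  proof
    assume "c = 0"
    \<comment> \<open>If c were 0, \<zeta> would vanish on Re s > 1, and continuity at 1 would
      contradict the residue being 1.\<close>
    have "(\<lambda>n. pole_free_zeta (1 + of_real (inverse (real (Suc n))))) \<longlonglongrightarrow> pole_free_zeta (1 + of_real 0)"
      by (intro isCont_tendsto_compose[OF isCont_pole_free_zeta] tendsto_intros LIMSEQ_inverse_real_of_nat) auto
    moreover have "pole_free_zeta (1 + of_real (inverse (real (Suc n)))) = 0" for n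
    proof -
      define x where "x = inverse (real (Suc n))"
      have "x > 0" unfolding x_def by simp
      with eq[of "1 + of_real x"] \<open>c = 0\<close> show ?thesis
        unfolding x_def[symmetric] by (auto simp: zeta_def)
    qed
    ultimately have "(\<lambda>n::nat. 0) \<longlonglongrightarrow> pole_free_zeta 1" by simp
    then show False using LIMSEQ_unique[OF tendsto_const] pole_free_zeta_1 by fastforce
  qed
  with eq show ?thesis by (intro that) auto
qed

section \<open>The 3-4-1 inequality and lower bounds for |\<zeta>|\<close>

lemma three_four_one: "3 + 4 * cos x + cos (2 * x) \<ge> (0::real)"
proof -
  have "3 + 4 * cos x + cos (2 * x) = 2 * (1 + cos x)\<^sup>2"
    using cos_double_cos[of x] by (simp add: power2_eq_square algebra_simps)
  then show ?thesis by simp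
qed

text \<open>The coefficients are nonnegative and Re n^(-it) = cos (t ln n), so the trigonometric
  inequality applies term by term.\<close>

lemma log_zeta_three_four_one:
  assumes "\<sigma> > 1"
  shows "3 * Re (log_zeta (of_real \<sigma>)) + 4 * Re (log_zeta (Complex \<sigma> t)) + Re (log_zeta (Complex \<sigma> (2 * t))) \<ge> 0"
proof -
  define a :: "nat \<Rightarrow> real" where "a = (\<lambda>n. mangoldt n / ln (real n))"
  have a: "a n \<ge> 0" for n
    unfolding a_def using mangoldt_nonneg[of n] by (cases "n = 0") auto
  have Re_term: "Re (of_real (a n) * of_nat n powr (- Complex \<sigma> u)) = a n * real n powr (-\<sigma>) * cos (u * ln (real n))" for n u
  proof (cases "n = 0")
    case False
    have "- Complex \<sigma> u * of_real (ln (real n)) = Complex (- \<sigma> * ln (real n)) (- u * ln (real n))"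
      by (simp add: complex_eq_iff)
    then have "of_nat n powr (- Complex \<sigma> u) = exp (Complex (- \<sigma> * ln (real n)) (- u * ln (real n)))"
      using False by (simp only: powr_def Ln_of_nat) simp
    then show ?thesis using False
      by (simp add: Re_exp powr_def)
  qed auto
  have S: "(\<lambda>n. a n * real n powr (-\<sigma>) * cos (u * ln (real n))) sums Re (log_zeta (Complex \<sigma> u))" for u
  proof -
    have "abs_conv a" "log_zeta = dirichlet a"
      using abs_conv_log_zeta by (simp_all add: a_def log_zeta_def)
    then show ?thesis
      using sums_Re[OF dirichlet_sums[of a "Complex \<sigma> u"]] assms by (simp only: Re_term complex.sel)
  qed
  have "(\<lambda>n. 3 * (a n * real n powr (-\<sigma>) * cos (0 * ln (real n))) + 4 * (a n * real n powr (-\<sigma>) * cos (t * ln (real n)))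
          + a n * real n powr (-\<sigma>) * cos (2 * t * ln (real n)))
        sums (3 * Re (log_zeta (Complex \<sigma> 0)) + 4 * Re (log_zeta (Complex \<sigma> t)) + Re (log_zeta (Complex \<sigma> (2 * t))))"
    by (intro sums_add sums_mult S)
  then have "3 * Re (log_zeta (Complex \<sigma> 0)) + 4 * Re (log_zeta (Complex \<sigma> t)) + Re (log_zeta (Complex \<sigma> (2 * t))) \<ge> 0"
  proof (rule sums_le[OF _ sums_zero, rotated])
    fix n
    have "0 \<le> a n * real n powr (-\<sigma>) * (3 + 4 * cos (t * ln (real n)) + cos (2 * (t * ln (real n))))"
      using a by (intro mult_nonneg_nonneg three_four_one) auto
    then show "0 \<le> 3 * (a n * real n powr (-\<sigma>) * cos (0 * ln (real n))) + 4 * (a n * real n powr (-\<sigma>) * cos (t * ln (real n)))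
          + a n * real n powr (-\<sigma>) * cos (2 * t * ln (real n))"
      by (simp add: algebra_simps)
  qed
  then show ?thesis by (simp add: complex_of_real_def)
qed

lemma zeta_three_four_one:
  obtains c where "c > 0"
    "\<And>\<sigma> t. \<sigma> > 1 \<Longrightarrow> norm (zeta (of_real \<sigma>)) ^ 3 * norm (zeta (Complex \<sigma> t)) ^ 4 * norm (zeta (Complex \<sigma> (2 * t))) \<ge> c"
proof -
  obtain c where c: "c \<noteq> 0" "\<And>s. Re s > 1 \<Longrightarrow> zeta s = c * exp (log_zeta s)"
    using zeta_eq_exp_log_zeta by blast
  show ?thesis
  \<comment> \<open>The exponent is 3 + 4 + 1: each zeta factor contributes one |c|.\<close>
  proof (rule that[of "norm c ^ 8"])
    fix \<sigma> t :: real assume \<sigma>: "\<sigma> > 1"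
    let ?L = "\<lambda>u. Re (log_zeta (Complex \<sigma> u))"
    have n: "norm (zeta (Complex \<sigma> u)) = norm c * exp (?L u)" for u
      using \<sigma> by (simp add: c norm_mult)
    have "norm c ^ 8 * 1 \<le> norm c ^ 8 * exp (3 * ?L 0 + 4 * ?L t + ?L (2 * t))"
      using log_zeta_three_four_one[OF \<sigma>, of t] 
      by (intro mult_left_mono) (auto simp: complex_of_real_def)
    also have "\<dots> = norm (zeta (Complex \<sigma> 0)) ^ 3 * norm (zeta (Complex \<sigma> t)) ^ 4 * norm (zeta (Complex \<sigma> (2 * t)))"
    proof -
      have "exp (3 * ?L 0) = exp (?L 0) ^ 3" "exp (4 * ?L t) = exp (?L t) ^ 4"
        by (simp_all flip: exp_of_nat_mult)
      then show ?thesis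
        unfolding n exp_add by (simp add: power_mult_distrib eval_nat_numeral mult_ac)
    qed
    finally show "norm c ^ 8 \<le> norm (zeta (of_real \<sigma>)) ^ 3 * norm (zeta (Complex \<sigma> t)) ^ 4 * norm (zeta (Complex \<sigma> (2 * t)))"
      by (simp add: complex_of_real_def)
  qed (use c in auto)
qed

lemma zeta_pole_bound:
  obtains C where "C > 0" "\<And>\<sigma>. 1 < \<sigma> \<Longrightarrow> \<sigma> \<le> 2 \<Longrightarrow> norm (zeta (of_real \<sigma>)) \<le> C / (\<sigma> - 1)"
proof -
  have "continuous_on (complex_of_real ` {1..2}) pole_free_zeta"
    by (rule continuous_on_subset[OF holomorphic_on_imp_continuous_on[OF holomorphic_pole_free_zeta]]) auto
  then have "bounded (pole_free_zeta ` (complex_of_real ` {1..2}))"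
    by (intro compact_imp_bounded compact_continuous_image) (auto intro!: continuous_intros)
  then obtain C where C: "C > 0" "\<And>\<sigma>. 1 \<le> \<sigma> \<Longrightarrow> \<sigma> \<le> 2 \<Longrightarrow> norm (pole_free_zeta (of_real \<sigma>)) \<le> C"
    unfolding bounded_pos by force
  show ?thesis
  proof (rule that[of C])
    fix \<sigma> :: real assume \<sigma>: "1 < \<sigma>" "\<sigma> \<le> 2"
    have "norm (complex_of_real \<sigma> - 1) = \<sigma> - 1"
      using \<sigma> norm_of_real[of "\<sigma> - 1", where ?'a = complex] by simp
    then show "norm (zeta (of_real \<sigma>)) \<le> C / (\<sigma> - 1)"
      using C(2)[of \<sigma>] \<sigma> by (simp add: zeta_def norm_divide divide_right_mono)
  qed (fact C)
qed

text \<open>The inequality of \<open>zeta_three_four_one\<close> gives \<open>|\<zeta>(\<sigma> + it)|\<^sup>4 \<ge> K (\<sigma> - 1)\<^sup>3 |t|\<^sup>-\<^sup>\<eta>\<close>. With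
  \<open>\<sigma> - 1 = \<delta> = \<rho> |t|\<^sup>-\<^sup>5\<^sup>\<eta>\<close> and \<open>\<rho>\<close> small this lower bound exceeds twice the variation of \<open>\<zeta>\<close> over
  a horizontal segment of length \<open>\<delta>\<close>.\<close>

lemma zeta_lower_bound:
  assumes "0 < \<eta>" "\<eta> < 1" "t0 > 0"
  obtains \<kappa> where "\<kappa> > 0"
    "\<And>s. 1 \<le> Re s \<Longrightarrow> Re s \<le> 2 \<Longrightarrow> \<bar>Im s\<bar> \<ge> t0 \<Longrightarrow> norm (zeta s) \<ge> \<kappa> * (1 + \<bar>Im s\<bar>) powr (- (4 * \<eta>))"
proof -
  obtain C1 where C1: "C1 > 0"
    "\<And>s. 1 - \<eta> \<le> Re s \<Longrightarrow> Re s \<le> 3 \<Longrightarrow> \<bar>Im s\<bar> \<ge> t0 \<Longrightarrow> norm (zeta s) \<le> C1 * (1 + \<bar>Im s\<bar>) powr \<eta>"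
    using zeta_growth[OF assms] by blast
  obtain C2 where C2: "C2 > 0"
    "\<And>k s. k \<le> 3 \<Longrightarrow> 1 \<le> Re s \<Longrightarrow> Re s \<le> 2 \<Longrightarrow> \<bar>Im s\<bar> \<ge> t0 \<Longrightarrow>
       norm ((deriv ^^ k) zeta s) \<le> C2 * (1 + \<bar>Im s\<bar>) powr \<eta>"
    using zeta_deriv_growth[OF assms] by blast
  obtain C3 where C3: "C3 > 0" "\<And>\<sigma>. 1 < \<sigma> \<Longrightarrow> \<sigma> \<le> 2 \<Longrightarrow> norm (zeta (of_real \<sigma>)) \<le> C3 / (\<sigma> - 1)"
    using zeta_pole_bound by blast
  obtain c where c: "c > 0"
    "\<And>\<sigma> t. \<sigma> > 1 \<Longrightarrow> norm (zeta (of_real \<sigma>)) ^ 3 * norm (zeta (Complex \<sigma> t)) ^ 4 * norm (zeta (Complex \<sigma> (2 * t))) \<ge> c"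
    using zeta_three_four_one by blast
  define K where "K = c / (C3 ^ 3 * (2 * C1))"
  have K: "K > 0" using c C1 C3 by (simp add: K_def)
  have lower: "norm (zeta (Complex \<sigma> t)) ^ 4 \<ge> K * (\<sigma> - 1) ^ 3 * (1 + \<bar>t\<bar>) powr (-\<eta>)"
    if \<sigma>: "1 < \<sigma>" "\<sigma> \<le> 2" and t: "\<bar>t\<bar> \<ge> t0" for \<sigma> t
  proof -
    let ?x = "norm (zeta (Complex \<sigma> t)) ^ 4"
    have "norm (zeta (Complex \<sigma> (2 * t))) \<le> C1 * (1 + \<bar>2 * t\<bar>) powr \<eta>"
      using C1(2)[of "Complex \<sigma> (2 * t)"] \<sigma> t assms by auto
    also have "\<dots> \<le> C1 * (2 * (1 + \<bar>t\<bar>)) powr \<eta>"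
      using C1 assms by (intro mult_left_mono powr_mono2) auto
    also have "\<dots> = C1 * (2 powr \<eta> * (1 + \<bar>t\<bar>) powr \<eta>)" by (subst powr_mult) auto
    also have "\<dots> \<le> C1 * (2 powr 1 * (1 + \<bar>t\<bar>) powr \<eta>)"
      using C1 assms by (intro mult_left_mono mult_right_mono powr_mono) auto
    finally have z2: "norm (zeta (Complex \<sigma> (2 * t))) \<le> 2 * C1 * (1 + \<bar>t\<bar>) powr \<eta>" by simp
    have "c \<le> norm (zeta (of_real \<sigma>)) ^ 3 * ?x * norm (zeta (Complex \<sigma> (2 * t)))"
      using \<sigma> by (intro c)
    also have "\<dots> \<le> (C3 / (\<sigma> - 1)) ^ 3 * ?x * (2 * C1 * (1 + \<bar>t\<bar>) powr \<eta>)"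
      using z2 C3 \<sigma> by (intro mult_mono power_mono) auto
    finally have "c \<le> (C3 / (\<sigma> - 1)) ^ 3 * ?x * (2 * C1 * (1 + \<bar>t\<bar>) powr \<eta>)" .
    then show ?thesis using \<sigma> C1 C3 by (simp add: K_def powr_minus field_simps)
  qed
  \<comment> \<open>Chosen together with \<kappa> so that (2\<kappa>)^4 = K \<rho>^3 and C2 \<rho>
    \<le> \<kappa>: the first gives the lower bound at distance \<delta> from Re s = 1, the second
    limits the variation of \<zeta> to half of it.\<close>
  define \<rho> where "\<rho> = min 1 (K / (16 * C2 ^ 4))"
  have \<rho>: "\<rho> > 0" "\<rho> \<le> 1" "C2 ^ 4 * \<rho> \<le> K / 16"
    using K C2 by (auto simp: \<rho>_def min_def field_simps)
  define \<kappa> where "\<kappa> = root 4 (K * \<rho> ^ 3 / 16)"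
  have \<kappa>: "\<kappa> > 0" "\<kappa> ^ 4 = K * \<rho> ^ 3 / 16" using K \<rho> by (auto simp: \<kappa>_def)
  show ?thesis
  proof (rule that[OF \<kappa>(1)])
    fix s assume s: "1 \<le> Re s" "Re s \<le> 2" "\<bar>Im s\<bar> \<ge> t0"
    define T where "T = 1 + \<bar>Im s\<bar>"
    have T: "T \<ge> 1" by (simp add: T_def)
    \<comment> \<open>The exponent 5\<eta> serves both sides: T^\<eta> T^(-5\<eta>) = T^(-4\<eta>)
      for the variation, and T^(-15\<eta>) T^(-\<eta>) is the fourth power of T^(-4\<eta>) for the
      lower bound.\<close>
    define \<delta> where "\<delta> = \<rho> * T powr (- (5 * \<eta>))"
    have "T powr (- (5 * \<eta>)) \<le> T powr 0" using T assms by (intro powr_mono) auto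
    then have "T powr (- (5 * \<eta>)) \<le> 1" using T by simp
    then have \<delta>: "\<delta> > 0" "\<delta> \<le> 1" using \<rho> T mult_mono[of \<rho> 1 "T powr (- (5 * \<eta>))" 1] by (auto simp: \<delta>_def)
    have large: "norm (zeta (Complex \<sigma> (Im s))) \<ge> 2 * \<kappa> * T powr (- (4 * \<eta>))" if \<sigma>: "1 + \<delta> \<le> \<sigma>" "\<sigma> \<le> 2" for \<sigma>
    proof (rule power_le_imp_le_base[of _ 3])
      have "(T powr (- (4 * \<eta>))) ^ 4 = T powr (- (16 * \<eta>))" "(T powr (- (5 * \<eta>))) ^ 3 = T powr (- (15 * \<eta>))"
        using T by (simp_all add: powr_power)
      then have "(2 * \<kappa> * T powr (- (4 * \<eta>))) ^ Suc 3 = K * \<delta> ^ 3 * T powr (-\<eta>)"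
        using \<kappa>(2) powr_add[of T "- (15 * \<eta>)" "- \<eta>"]
        by (simp add: \<delta>_def power_mult_distrib mult.assoc)
      also have "\<dots> \<le> K * (\<sigma> - 1) ^ 3 * T powr (-\<eta>)"
        using K \<delta> \<sigma> by (intro mult_right_mono mult_left_mono power_mono) auto
      also have "\<dots> \<le> norm (zeta (Complex \<sigma> (Im s))) ^ 4"
        unfolding T_def using \<sigma> \<delta> s by (intro lower) auto
      finally show "(2 * \<kappa> * T powr (- (4 * \<eta>))) ^ Suc 3 \<le> norm (zeta (Complex \<sigma> (Im s))) ^ Suc 3" by simp
    qed auto
    have "\<kappa> * T powr (- (4 * \<eta>)) \<le> norm (zeta s)"
    proof (cases "Re s \<ge> 1 + \<delta>")
      case True
      have "\<kappa> * T powr (- (4 * \<eta>)) \<le> 2 * \<kappa> * T powr (- (4 * \<eta>))" using \<kappa> T by simp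
      with large[OF True s(2)] show ?thesis by simp
    next
      case False
      let ?s' = "Complex (1 + \<delta>) (Im s)"
      let ?S = "closed_segment s ?s'"
      have S: "1 \<le> Re x \<and> Re x \<le> 2 \<and> Im x = Im s" if "x \<in> ?S" for x
      proof -
        from that obtain u where u: "0 \<le> u" "u \<le> 1" "x = (1 - u) *\<^sub>R s + u *\<^sub>R ?s'"
          by (auto simp: closed_segment_def)
        have "Re x = Re s + u * (1 + \<delta> - Re s)" by (simp add: u(3) algebra_simps)
        moreover have "0 \<le> u * (1 + \<delta> - Re s)" using u False by auto
        moreover have "u * (1 + \<delta> - Re s) \<le> 1 * (1 + \<delta> - Re s)" using u False by (intro mult_right_mono) auto
        moreover have "Im x = Im s" by (simp add: u(3) algebra_simps)
        ultimately show ?thesis using s \<delta> by auto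
      qed
      have "norm (zeta ?s' - zeta s) \<le> C2 * T powr \<eta> * norm (?s' - s)"
      proof (rule field_differentiable_bound[of ?S zeta "deriv zeta"])
        fix z assume z: "z \<in> ?S"
        have "z \<in> {s. Re s > 0} - {1}" using S[OF z] s assms by auto
        moreover have "open ({s. Re s > (0::real)} - {1})" by (intro open_Diff open_halfspace_Re_gt) auto
        ultimately show "(zeta has_field_derivative deriv zeta z) (at z within ?S)"
          using holomorphic_zeta by (meson holomorphic_derivI has_field_derivative_at_within)
        show "norm (deriv zeta z) \<le> C2 * T powr \<eta>"
          using C2(2)[of 1 z] S[OF z] s by (simp add: T_def)
      qed auto
      also have "norm (?s' - s) \<le> \<delta>"
      proof -
        have "?s' - s = of_real (1 + \<delta> - Re s)" by (simp add: complex_eq_iff)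
        then show ?thesis using False s by (simp only: norm_of_real)
      qed
      then have "C2 * T powr \<eta> * norm (?s' - s) \<le> C2 * T powr \<eta> * \<delta>"
        using C2 by (intro mult_left_mono) auto
      also have "C2 * T powr \<eta> * \<delta> = C2 * \<rho> * T powr (- (4 * \<eta>))"
        using T by (simp add: \<delta>_def flip: powr_add)
      also have "\<dots> \<le> \<kappa> * T powr (- (4 * \<eta>))"
      proof (intro mult_right_mono power_le_imp_le_base[of "C2 * \<rho>" 3 \<kappa>])
        have "(C2 * \<rho>) ^ 4 = (C2 ^ 4 * \<rho>) * \<rho> ^ 3" by (simp add: power_mult_distrib eval_nat_numeral)
        also have "\<dots> \<le> K / 16 * \<rho> ^ 3" using \<rho> by (intro mult_right_mono) auto
        finally show "(C2 * \<rho>) ^ Suc 3 \<le> \<kappa> ^ Suc 3" using \<kappa>(2) by simp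
      qed (use \<kappa> in auto)
      finally have "norm (zeta ?s' - zeta s) \<le> \<kappa> * T powr (- (4 * \<eta>))" .
      moreover have "norm (zeta ?s') \<ge> 2 * \<kappa> * T powr (- (4 * \<eta>))"
        using \<delta> by (intro large) auto
      moreover have "norm (zeta ?s') \<le> norm (zeta ?s' - zeta s) + norm (zeta s)" by norm
      ultimately show ?thesis by linarith
    qed
    then show "\<kappa> * (1 + \<bar>Im s\<bar>) powr (- (4 * \<eta>)) \<le> norm (zeta s)" by (simp add: T_def)
  qed
qed

text \<open>Multiplying by s - 1 lets the point 1 be included, so -\<zeta>'/\<zeta> can be continued
  past its pole. On Re s = 1 off the real axis the quantitative bound is applied with t0 = |Im s|;
  the choice \<eta> = 1/2 is arbitrary.\<close>

lemma pole_free_zeta_nonzero: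
  assumes "Re s \<ge> 1"
  shows "pole_free_zeta s \<noteq> 0"
proof -
  consider "s = 1" | "Re s > 1" | "Re s = 1" "Im s \<noteq> 0"
    using assms by (force simp: complex_eq_iff)
  then show ?thesis
  proof cases
    case 2
    obtain c where "c \<noteq> 0" "\<And>s. Re s > 1 \<Longrightarrow> zeta s = c * exp (log_zeta s)"
      using zeta_eq_exp_log_zeta by blast
    with 2 have "zeta s \<noteq> 0" by simp
    then show ?thesis by (auto simp: zeta_def)
  next
    case 3
    obtain \<kappa> where "\<kappa> > 0"
      "\<And>z. 1 \<le> Re z \<Longrightarrow> Re z \<le> 2 \<Longrightarrow> \<bar>Im z\<bar> \<ge> \<bar>Im s\<bar> \<Longrightarrow> norm (zeta z) \<ge> \<kappa> * (1 + \<bar>Im z\<bar>) powr (- (4 * (1/2)))"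
      using zeta_lower_bound[of "1/2" "\<bar>Im s\<bar>"] 3 by auto
    from this(1) this(2)[of s] 3 have "norm (zeta s) > 0"
      by (smt (verit, best) mult_pos_pos powr_gt_zero)
    then show ?thesis by (auto simp: zeta_def)
  qed (simp add: pole_free_zeta_1)
qed

section \<open>The second derivative of \<open>-\<zeta>'/\<zeta> - \<zeta>\<close>\<close>

definition psi_coeff :: "nat \<Rightarrow> real" where
  "psi_coeff n = (mangoldt n - 1) * ln (real n) ^ 2"

lemma psi_coeff_eq: "psi_coeff n = mangoldt n * ln (real n) ^ 2 - ln (real n) ^ 2"
  by (simp add: psi_coeff_def algebra_simps)

lemma abs_conv_psi_coeff: "abs_conv psi_coeff"
  unfolding psi_coeff_eq[abs_def]
  by (intro abs_conv_diff abs_conv_ln_power abs_conv_mangoldt_ln_power)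

lemma dirichlet_psi_coeff:
  assumes "Re s > 1"
  shows "dirichlet psi_coeff s = mangoldt_series 2 s - log_series 2 s"
  unfolding psi_coeff_eq[abs_def]
  by (intro dirichlet_diff abs_conv_ln_power abs_conv_mangoldt_ln_power assms)

lemma dirichlet_psi_coeff_bound_far:
  obtains C where "C > 0"
    "\<And>s. 1 < Re s \<Longrightarrow> Re s \<le> 2 \<Longrightarrow> \<bar>Im s\<bar> \<ge> 1 \<Longrightarrow> norm (dirichlet psi_coeff s) \<le> C * (1 + \<bar>Im s\<bar>) powr (1/2)"
proof -
  \<comment> \<open>Three nested divisions by \<zeta>, each costing T^(4\<eta>) for 1/\<zeta> and
    T^\<eta> for the numerator, give T^(15\<eta>) = T^(1/2). Any final exponent below 1 would be
    integrable against the kernel.\<close>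
  define \<eta> :: real where "\<eta> = 1/30"
  have \<eta>: "0 < \<eta>" "\<eta> < 1" by (auto simp: \<eta>_def)
  obtain C where C: "C > 0"
    "\<And>k s. k \<le> 3 \<Longrightarrow> 1 \<le> Re s \<Longrightarrow> Re s \<le> 2 \<Longrightarrow> \<bar>Im s\<bar> \<ge> 1 \<Longrightarrow>
       norm ((deriv ^^ k) zeta s) \<le> C * (1 + \<bar>Im s\<bar>) powr \<eta>"
    using zeta_deriv_growth[OF \<eta>, of 1] by auto
  obtain \<kappa> where \<kappa>: "\<kappa> > 0"
    "\<And>s. 1 \<le> Re s \<Longrightarrow> Re s \<le> 2 \<Longrightarrow> \<bar>Im s\<bar> \<ge> 1 \<Longrightarrow> norm (zeta s) \<ge> \<kappa> * (1 + \<bar>Im s\<bar>) powr (- (4 * \<eta>))"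
    using zeta_lower_bound[OF \<eta>, of 1] by auto
  define A where "A = max 1 (max (1 / \<kappa>) C)"
  have A: "A \<ge> 1" "A \<ge> 1 / \<kappa>" "A \<ge> C" by (auto simp: A_def)
  show ?thesis
  proof (rule that[of "7 * A ^ 6"])
    show "7 * A ^ 6 > 0" using A by simp
    fix s assume s: "1 < Re s" "Re s \<le> 2" "\<bar>Im s\<bar> \<ge> 1"
    define T where "T = 1 + \<bar>Im s\<bar>"
    define X where "X = A ^ 2 * T powr (5 * \<eta>)"
    have T: "T \<ge> 1" by (simp add: T_def)
    have Tpow: "T powr a \<ge> 1" if "a \<ge> 0" for a using T that by (simp add: ge_one_powr_ge_zero)
    have X1: "X \<ge> 1"
      unfolding X_def using A Tpow[of "5 * \<eta>"] \<eta> mult_mono[of 1 "A^2" 1 "T powr (5 * \<eta>)"] by simp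
    have E: "norm (log_series k s) \<le> A * T powr \<eta>" if "k \<le> 3" for k
    proof -
      have "norm (log_series k s) = norm ((deriv ^^ k) zeta s)"
        using s by (simp add: higher_deriv_zeta norm_mult norm_power)
      also have "\<dots> \<le> C * T powr \<eta>" unfolding T_def using C(2)[OF that] s by simp
      also have "\<dots> \<le> A * T powr \<eta>" using A by (intro mult_right_mono) auto
      finally show ?thesis .
    qed
    \<comment> \<open>One division by \<zeta>, at the price of a factor X. Applied to the three
      series identities it gives the bounds X, 2 X^2 and 6 X^3.\<close>
    have inv: "norm z \<le> X * y" if "norm (log_series 0 s * z) \<le> A * T powr \<eta> * y" "y \<ge> 0" for z y
    proof -
      have "\<kappa> * T powr (- (4 * \<eta>)) * norm z \<le> norm (log_series 0 s) * norm z"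
        using \<kappa>(2)[of s] s by (intro mult_right_mono) (auto simp: T_def zeta_eq_series)
      also have "\<dots> \<le> A * T powr \<eta> * y" using that(1) by (simp add: norm_mult)
      finally have "norm z \<le> 1 / \<kappa> * (T powr (4 * \<eta>) * (A * T powr \<eta> * y))"
        using \<kappa>(1) T by (simp add: powr_minus field_simps)
      also have "\<dots> \<le> A * (T powr (4 * \<eta>) * (A * T powr \<eta> * y))"
        using A that(2) by (intro mult_right_mono) auto
      also have "\<dots> = A ^ 2 * (T powr (4 * \<eta>) * T powr \<eta>) * y" by (simp add: power2_eq_square)
      also have "T powr (4 * \<eta>) * T powr \<eta> = T powr (5 * \<eta>)" by (simp flip: powr_add)
      finally show ?thesis by (simp add: X_def)
    qed
    let ?M = "\<lambda>k. mangoldt_series k s" and ?E = "\<lambda>k. log_series k s"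
    define B where "B = A * T powr \<eta>"
    have B: "B \<ge> 0" "B \<le> X ^ 3"
    proof -
      show "B \<ge> 0" using A by (simp add: B_def)
      have "B \<le> X" unfolding B_def X_def
        using A T \<eta> by (intro mult_mono powr_mono) (auto simp: power2_eq_square)
      also have "X ^ 1 \<le> X ^ 3" using X1 by (intro power_increasing) auto
      then have "X \<le> X ^ 3" by simp
      finally show "B \<le> X ^ 3" .
    qed
    have pw: "X \<le> X ^ 2" "1 \<le> X ^ 2" using X1 one_le_power[OF X1, of 2] by (simp_all add: self_le_power)
    note E = E[folded B_def] and inv = inv[folded B_def]
    have M0: "norm (?M 0) \<le> X"
      using inv[of "?M 0" 1] series_identity_0[of s] E[of 1] s by simp
    have M1: "norm (?M 1) \<le> X * (2 * X)"
    proof (rule inv)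
      have "?E 0 * ?M 1 = ?E 2 - ?E 1 * ?M 0" using series_identity_1[of s] s by (simp add: algebra_simps)
      also have "norm \<dots> \<le> norm (?E 2) + norm (?E 1) * norm (?M 0)"
        using norm_triangle_ineq4[of "?E 2" "?E 1 * ?M 0"] by (simp only: norm_mult)
      also have "\<dots> \<le> B * 1 + B * X" using E[of 1] E[of 2] M0 B by (intro add_mono mult_mono) auto
      also have "\<dots> = B * (1 + X)" by (simp add: algebra_simps)
      also have "\<dots> \<le> B * (2 * X)" using X1 B by (intro mult_left_mono) auto
      finally show "norm (?E 0 * ?M 1) \<le> B * (2 * X)" .
    qed (use X1 in auto)
    have M2: "norm (?M 2) \<le> X * (6 * X ^ 2)"
    proof (rule inv)
      have "norm (a - b - 2 * c) \<le> norm a + norm b + 2 * norm c" for a b c :: complex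
        using norm_triangle_ineq4[of "a - b" "2 * c"] norm_triangle_ineq4[of a b] by (simp add: norm_mult)
      from this[of "?E 3" "?E 2 * ?M 0" "?E 1 * ?M 1"]
      have "norm (?E 3 - ?E 2 * ?M 0 - 2 * (?E 1 * ?M 1)) \<le> norm (?E 3) + norm (?E 2) * norm (?M 0) + 2 * (norm (?E 1) * norm (?M 1))"
        by (simp only: norm_mult)
      moreover have "norm (?E 2) * norm (?M 0) \<le> B * X" "norm (?E 1) * norm (?M 1) \<le> B * (X * (2 * X))"
        using E[of 1] E[of 2] M0 M1 B by (intro mult_mono; simp)+
      moreover have "?E 0 * ?M 2 = ?E 3 - ?E 2 * ?M 0 - 2 * (?E 1 * ?M 1)"
        using series_identity_2[of s] s by (simp add: algebra_simps)
      ultimately have "norm (?E 0 * ?M 2) \<le> B + B * X + 2 * (B * (X * (2 * X)))"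
        using E[of 3] by simp
      also have "\<dots> = B * (1 + X + 4 * X ^ 2)" by (simp add: algebra_simps power2_eq_square)
      also have "\<dots> \<le> B * (6 * X ^ 2)" using pw B by (intro mult_left_mono) auto
      finally show "norm (?E 0 * ?M 2) \<le> B * (6 * X ^ 2)" .
    qed (use X1 in auto)
    have "(T powr (5 * \<eta>)) ^ 3 = T powr (1/2)" using T by (simp add: powr_power \<eta>_def)
    then have X3: "X ^ 3 = A ^ 6 * T powr (1/2)"
      by (simp add: X_def power_mult_distrib flip: power_mult)
    have "norm (dirichlet psi_coeff s) \<le> norm (?M 2) + norm (?E 2)"
      using s by (simp add: dirichlet_psi_coeff norm_triangle_ineq4)
    moreover have "X * (6 * X ^ 2) = 6 * X ^ 3" by (simp add: eval_nat_numeral)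
    ultimately have "norm (dirichlet psi_coeff s) \<le> 7 * X ^ 3"
      using M2 E[of 2] B by simp
    then show "norm (dirichlet psi_coeff s) \<le> 7 * A ^ 6 * (1 + \<bar>Im s\<bar>) powr (1/2)"
      by (simp add: X3 T_def)
  qed
qed

lemma dirichlet_psi_coeff_bound_near:
  obtains C where "C > 0"
    "\<And>s. 1 < Re s \<Longrightarrow> Re s \<le> 2 \<Longrightarrow> \<bar>Im s\<bar> \<le> 1 \<Longrightarrow> norm (dirichlet psi_coeff s) \<le> C"
proof -
  let ?Z = pole_free_zeta
  define U where "U = {s. Re s > 0} \<inter> ?Z -` (- {0})"
  have opn: "open {s. Re s > (0::real)}" by (simp add: open_halfspace_Re_gt)
  have U: "open U" unfolding U_def
    by (rule continuous_open_preimage[OF holomorphic_on_imp_continuous_on[OF holomorphic_pole_free_zeta] opn]) auto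
  \<comment> \<open>With Z = (s - 1) \<zeta> and Z(1) = 1, one has \<zeta> = 1/(s - 1) + P and
    -\<zeta>'/\<zeta> = 1/(s - 1) - Z'/Z. The polar parts cancel in F, and P has only a removable
    singularity.\<close>
  define P where "P = (\<lambda>s. if s = 1 then deriv ?Z 1 else (?Z s - ?Z 1) / (s - 1))"
  define F where "F = (\<lambda>s. - (deriv ?Z s / ?Z s) - P s)"
  have "P holomorphic_on {s. Re s > 0}" unfolding P_def
    by (rule pole_lemma_open[OF holomorphic_pole_free_zeta opn])
  then have "F holomorphic_on U" unfolding F_def
    by (intro holomorphic_intros holomorphic_on_subset[OF holomorphic_pole_free_zeta]
          holomorphic_on_subset[OF holomorphic_deriv[OF holomorphic_pole_free_zeta opn]])
       (auto simp: U_def elim: holomorphic_on_subset)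
  then have "(deriv ^^ 2) F holomorphic_on U"
    by (rule holomorphic_higher_deriv[OF _ U])
  then have "continuous_on U ((deriv ^^ 2) F)" by (rule holomorphic_on_imp_continuous_on)
  \<comment> \<open>The closed box touches Re s = 1, so nonvanishing up to that line is what makes
    the compactness argument work.\<close>
  then have "continuous_on (cbox (Complex 1 (-1)) (Complex 2 1)) ((deriv ^^ 2) F)"
    by (rule continuous_on_subset) (auto simp: U_def in_cbox_complex_iff pole_free_zeta_nonzero)
  then have "bounded ((deriv ^^ 2) F ` cbox (Complex 1 (-1)) (Complex 2 1))"
    by (intro compact_imp_bounded compact_continuous_image) auto
  then obtain C where C: "C > 0"
    "\<And>s. s \<in> cbox (Complex 1 (-1)) (Complex 2 1) \<Longrightarrow> norm ((deriv ^^ 2) F s) \<le> C"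
    unfolding bounded_pos by force
  have F: "F s = mangoldt_series 0 s - log_series 0 s" if s: "Re s > 1" for s
  proof -
    have "((\<lambda>s. ?Z s / (s - 1)) has_field_derivative (deriv ?Z s * (s - 1) - ?Z s * 1) / ((s - 1) * (s - 1))) (at s)"
      using s by (intro DERIV_divide holomorphic_derivI[OF holomorphic_pole_free_zeta opn])
                 (auto intro!: derivative_eq_intros)
    then have "(deriv ?Z s * (s - 1) - ?Z s * 1) / ((s - 1) * (s - 1)) = - log_series 1 s"
      using has_field_derivative_log_series[OF s, of 0] s
      unfolding One_nat_def by (rule deriv_unique_halfplane) (auto simp flip: zeta_def zeta_eq_series)
    moreover have "log_series 0 s = ?Z s / (s - 1)" using zeta_eq_series[OF s] by (simp add: zeta_def)
    moreover have "mangoldt_series 0 s = log_series 1 s / log_series 0 s"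
    proof -
      have "log_series 0 s \<noteq> 0"
        using zeta_eq_series[OF s] pole_free_zeta_nonzero[of s] s by (auto simp: zeta_def)
      then show ?thesis using series_identity_0[OF s] by (simp add: field_simps)
    qed
    moreover have "- ((z' * w - z * 1) / (w * w)) / (z / w) - z / w = - (z' / z) - (z - 1) / w"
      if "w \<noteq> 0" "z \<noteq> 0" for z z' w :: complex
      using that by (simp add: field_simps)
    from this[of "s - 1" "?Z s" "deriv ?Z s"]
    have "- ((deriv ?Z s * (s - 1) - ?Z s * 1) / ((s - 1) * (s - 1))) / (?Z s / (s - 1)) - ?Z s / (s - 1) = F s"
      using pole_free_zeta_nonzero[of s] s pole_free_zeta_1 by (auto simp: F_def P_def)
    ultimately show ?thesis by simp
  qed
  have "(deriv ^^ 2) F s = dirichlet psi_coeff s" if s: "Re s > 1" for s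
  proof -
    have D: "((\<lambda>z. mangoldt_series k z - log_series k z) has_field_derivative
        - mangoldt_series (Suc k) z - - log_series (Suc k) z) (at z)" if "Re z > 1" for k z
      by (intro DERIV_diff has_field_derivative_mangoldt_series has_field_derivative_log_series that)
    have D1: "deriv F z = - (mangoldt_series 1 z - log_series 1 z)" if z: "Re z > 1" for z
    proof -
      have "(F has_field_derivative - mangoldt_series (Suc 0) z - - log_series (Suc 0) z) (at z)"
        by (rule has_field_derivative_transform_within_open[OF D open_halfspace_Re_gt[of 1]]) (use z F in auto)
      then show ?thesis by (simp add: DERIV_imp_deriv)
    qed
    have "(deriv F has_field_derivative - (- mangoldt_series (Suc 1) s - - log_series (Suc 1) s)) (at s)"
      by (rule has_field_derivative_transform_within_open[OF DERIV_minus[OF D] open_halfspace_Re_gt[of 1]]) (use s D1 in auto)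
    then have "deriv (deriv F) s = - (- mangoldt_series (Suc 1) s - - log_series (Suc 1) s)"
      by (rule DERIV_imp_deriv)
    then show ?thesis using s by (simp add: dirichlet_psi_coeff numeral_2_eq_2)
  qed
  moreover have "s \<in> cbox (Complex 1 (-1)) (Complex 2 1)" if "1 < Re s" "Re s \<le> 2" "\<bar>Im s\<bar> \<le> 1" for s
    using that by (auto simp: in_cbox_complex_iff)
  ultimately show ?thesis using C by (intro that[of C]) metis+
qed

lemma dirichlet_psi_coeff_bound:
  obtains C where "C > 0"
    "\<And>s. 1 < Re s \<Longrightarrow> Re s \<le> 2 \<Longrightarrow> norm (dirichlet psi_coeff s) \<le> C * (1 + \<bar>Im s\<bar>) powr (1/2)"
proof -
  obtain C where C: "C > 0" "\<And>s. 1 < Re s \<Longrightarrow> Re s \<le> 2 \<Longrightarrow> \<bar>Im s\<bar> \<ge> 1 \<Longrightarrow>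
      norm (dirichlet psi_coeff s) \<le> C * (1 + \<bar>Im s\<bar>) powr (1/2)"
    using dirichlet_psi_coeff_bound_far by blast
  obtain C' where C': "C' > 0" "\<And>s. 1 < Re s \<Longrightarrow> Re s \<le> 2 \<Longrightarrow> \<bar>Im s\<bar> \<le> 1 \<Longrightarrow> norm (dirichlet psi_coeff s) \<le> C'"
    using dirichlet_psi_coeff_bound_near by blast
  show ?thesis
  proof (rule that[of "C + C'"])
    fix s assume s: "1 < Re s" "Re s \<le> 2"
    have "C * 1 + C' * 1 \<le> C * (1 + \<bar>Im s\<bar>) powr (1/2) + C' * (1 + \<bar>Im s\<bar>) powr (1/2)"
      using C C' by (intro add_mono mult_left_mono) (auto simp: ge_one_powr_ge_zero)
    moreover have "C * (1 + \<bar>Im s\<bar>) powr (1/2) \<ge> 0" "C' * (1 + \<bar>Im s\<bar>) powr (1/2) \<ge> 0" using C C' by auto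
    moreover have "norm (dirichlet psi_coeff s) \<le> C * (1 + \<bar>Im s\<bar>) powr (1/2) \<or> norm (dirichlet psi_coeff s) \<le> C'"
      using C(2)[OF s] C'(2)[OF s] by linarith
    ultimately have "norm (dirichlet psi_coeff s) \<le> C * (1 + \<bar>Im s\<bar>) powr (1/2) + C' * (1 + \<bar>Im s\<bar>) powr (1/2)"
      using C(1) C'(1) by linarith
    then show "norm (dirichlet psi_coeff s) \<le> (C + C') * (1 + \<bar>Im s\<bar>) powr (1/2)"
      by (simp add: algebra_simps)
  qed (use C C' in auto)
qed

section \<open>A smoothed Perron formula\<close>

text \<open>For u = ln (y/n) this is (y/n)^s / (s (s + 1)). Compared with the classical kernel 1/s,
  the factor s + 1 gives absolute convergence, at the price of counting n with weight 1 -
  n/y.\<close>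

definition perron_kernel :: "real \<Rightarrow> complex \<Rightarrow> complex" where
  "perron_kernel u s = exp (of_real u * s) / (s * (s + 1))"

text \<open>The segment from \<open>\<sigma> - \<i>R\<close> to \<open>\<sigma> + \<i>R\<close> is compared with the circle of radius \<open>R\<close> around
  \<open>\<sigma>\<close>: it can be deformed into the right arc, and the whole circle picks up the residues at \<open>0\<close> and
  \<open>-1\<close>. For \<open>u \<le> 0\<close> the right arc is small, for \<open>u > 0\<close> the left one.\<close>

lemma perron_kernel_integral:
  fixes u \<sigma> R :: real
  assumes \<sigma>: "\<sigma> > 0" and R: "R \<ge> 2 * \<sigma> + 2"
  defines "E \<equiv> exp (u * \<sigma>) * (4 * pi / R)"
  shows "norm (contour_integral (linepath (Complex \<sigma> (-R)) (Complex \<sigma> R)) (perron_kernel u)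
            - 2 * of_real pi * \<i> * of_real (max 0 (1 - exp (- u)))) \<le> E"
proof -
  let ?f = "perron_kernel u"
  let ?c = "complex_of_real \<sigma>"
  let ?L = "linepath (Complex \<sigma> (-R)) (Complex \<sigma> R)"
  let ?right = "part_circlepath ?c R (-pi/2) (pi/2)"
  let ?left = "part_circlepath ?c R (pi/2) (3*pi/2)"
  \<comment> \<open>The second bound keeps the circle at distance at least R/2 from both poles 0 and
    -1.\<close>
  have R0: "R > 0" "R / 2 \<ge> \<sigma> + 1" using \<sigma> R by auto
  have hol: "?f holomorphic_on - {0, -1}"
    unfolding perron_kernel_def[abs_def] by (intro holomorphic_intros) (auto simp: eq_neg_iff_add_eq_0)
  have ends: "pathstart ?right = Complex \<sigma> (-R)" "pathfinish ?right = Complex \<sigma> R"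
             "pathstart ?left = Complex \<sigma> R" "pathfinish ?left = Complex \<sigma> (-R)"
  proof -
    have three_halves: "3 * pi / 2 = 3 / 2 * pi" by simp
    have "exp (\<i> * of_real (3 * pi / 2)) = - \<i>"
      unfolding cis_conv_exp[symmetric] three_halves
      by (simp add: complex_eq_iff cos_3over2_pi sin_3over2_pi del: times_divide_eq_left)
    moreover have "exp (\<i> * of_real (pi / 2)) = \<i>" "exp (\<i> * of_real (- pi / 2)) = - \<i>"
      unfolding cis_conv_exp[symmetric] by (simp_all add: complex_eq_iff)
    ultimately show "pathstart ?right = Complex \<sigma> (-R)" "pathfinish ?right = Complex \<sigma> R"
             "pathstart ?left = Complex \<sigma> R" "pathfinish ?left = Complex \<sigma> (-R)"
      by (simp_all only: pathstart_part_circlepath pathfinish_part_circlepath) (simp_all add: complex_eq_iff)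
  qed
  have on_circle: "norm (x - ?c) = R" if "x \<in> path_image (part_circlepath ?c R a b)" "a \<le> b" for x a b
    using in_path_image_part_circlepath[OF that(1)] that R0 by (auto simp: norm_minus_commute)
  have far: "norm x \<ge> R / 2" "norm (x + 1) \<ge> R / 2" if "norm (x - ?c) = R" for x
  proof -
    have "norm (x - ?c) \<le> norm x + norm ?c" "norm (x + 1 - of_real (\<sigma> + 1)) \<le> norm (x + 1) + norm (of_real (\<sigma> + 1) :: complex)"
      by (rule norm_triangle_ineq4)+
    moreover have "x + 1 - of_real (\<sigma> + 1) = x - ?c" by simp
    ultimately show "norm x \<ge> R / 2" "norm (x + 1) \<ge> R / 2"
      using that \<sigma> R0 by (simp_all only: norm_of_real)
  qed
  have int: "?f contour_integrable_on part_circlepath ?c R a b" for a b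
  proof (rule contour_integrable_continuous_part_circlepath)
    have "path_image (part_circlepath ?c R a b) \<subseteq> sphere ?c R"
      using R0 by (intro path_image_part_circlepath_subset') auto
    moreover have "sphere ?c R \<subseteq> - {0, -1}"
    proof
      fix x assume "x \<in> sphere ?c R"
      then have "norm (x - ?c) = R" by (simp add: dist_norm norm_minus_commute)
      from far[OF this] R0 show "x \<in> - {0, -1}" by auto
    qed
    ultimately have "path_image (part_circlepath ?c R a b) \<subseteq> - {0, -1}" by blast
    then show "continuous_on (path_image (part_circlepath ?c R a b)) ?f"
      by (rule continuous_on_subset[OF holomorphic_on_imp_continuous_on[OF hol]])
  qed
  have arc_bound: "norm (contour_integral (part_circlepath ?c R a b) ?f) \<le> E"
    if ab: "b - a = pi" and Re: "\<And>x. x \<in> path_image (part_circlepath ?c R a b) \<Longrightarrow> u * Re x \<le> u * \<sigma>" for a b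
  proof -
    have ab': "a \<le> b" using ab pi_gt_zero by linarith
    \<comment> \<open>Arc length pi R against the denominator (R/2)^2 gives the 4 pi / R in
      E.\<close>
    have "norm (contour_integral (part_circlepath ?c R a b) ?f) \<le> exp (u * \<sigma>) / (R / 2 * (R / 2)) * R * \<bar>b - a\<bar>"
    proof (rule contour_integral_bound_part_circlepath)
      show "?f contour_integrable_on part_circlepath ?c R a b" by (rule int)
      fix x assume x: "x \<in> path_image (part_circlepath ?c R a b)"
      have "norm (exp (of_real u * x)) \<le> exp (u * \<sigma>)"
        using Re[OF x] by simp
      then show "norm (?f x) \<le> exp (u * \<sigma>) / (R / 2 * (R / 2))"
        unfolding perron_kernel_def norm_divide norm_mult
        using far[OF on_circle[OF x ab']] R0 by (intro frac_le mult_mono) auto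
    qed (use R0 in auto)
    also have "\<dots> = E" using R0 ab by (simp add: E_def field_simps)
    finally show ?thesis .
  qed
  have right_Re: "Re x \<ge> \<sigma>" if "x \<in> path_image ?right" for x
  proof -
    from that obtain t where t: "t \<in> {-pi/2..pi/2}" "x = ?c + of_real R * exp (\<i> * of_real t)"
      using R0 pi_gt_zero by (auto simp: path_image_part_circlepath)
    have "cos t \<ge> 0" using t(1) by (intro cos_ge_zero) auto
    then show ?thesis using t(2) R0 by (simp add: exp_Euler cos_of_real sin_of_real)
  qed
  have left_Re: "Re x \<le> \<sigma>" if "x \<in> path_image ?left" for x
  proof -
    from that obtain t where t: "t \<in> {pi/2..3*pi/2}" "x = ?c + of_real R * exp (\<i> * of_real t)"
      using R0 pi_gt_zero by (auto simp: path_image_part_circlepath)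
    have "cos (t - pi) \<ge> 0" using t(1) by (intro cos_ge_zero) auto
    then have "cos t \<le> 0" by (simp add: cos_diff)
    then show ?thesis using t(2) R0 by (simp add: exp_Euler cos_of_real sin_of_real mult_nonneg_nonpos)
  qed
  have seg_eq: "contour_integral ?L ?f = contour_integral ?right ?f"
  proof -
    let ?H = "{s. Re s > 0}"
    have holH: "?f holomorphic_on ?H" by (rule holomorphic_on_subset[OF hol]) auto
    have segH: "path_image ?L \<subseteq> ?H"
      unfolding path_image_linepath using \<sigma> by (intro closed_segment_subset convex_halfspace_Re_gt) auto
    have arcH: "path_image ?right \<subseteq> ?H" using right_Re \<sigma> by force
    have revH: "path_image (reversepath ?right) \<subseteq> ?H" using arcH by (simp only: path_image_reversepath)
    have "(?f has_contour_integral 0) (?L +++ reversepath ?right)"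
    proof (rule Cauchy_theorem_convex_simple[OF holH convex_halfspace_Re_gt])
      show "valid_path (?L +++ reversepath ?right)"
        by (intro valid_path_join valid_path_linepath valid_path_imp_reverse valid_path_part_circlepath)
           (simp only: pathfinish_linepath pathstart_reversepath ends)
      show "path_image (?L +++ reversepath ?right) \<subseteq> ?H"
        using path_image_join_subset segH revH by fast
      show "pathfinish (?L +++ reversepath ?right) = pathstart (?L +++ reversepath ?right)"
        by (simp only: pathfinish_join pathstart_join pathfinish_reversepath pathstart_linepath ends)
    qed
    then have "contour_integral (?L +++ reversepath ?right) ?f = 0" by (rule contour_integral_unique)
    moreover have "?f contour_integrable_on ?L"
      by (intro contour_integrable_continuous_linepath holomorphic_on_imp_continuous_on
            holomorphic_on_subset[OF holH]) (use segH in auto)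
    moreover have "?f contour_integrable_on reversepath ?right"
      by (intro contour_integrable_reversepath int) simp
    ultimately have "contour_integral ?L ?f + contour_integral (reversepath ?right) ?f = 0"
      using contour_integral_join[of ?f ?L "reversepath ?right"]
      by (simp only: valid_path_linepath valid_path_imp_reverse valid_path_part_circlepath)
    then show ?thesis
      using contour_integral_reversepath[OF valid_path_part_circlepath[of ?c R "-pi/2" "pi/2"], of ?f]
      by (simp only: add_eq_0_iff2 minus_minus)
  qed
  show ?thesis
  proof (cases "u \<le> 0")
    case True
    have "norm (contour_integral ?right ?f) \<le> E"
      by (rule arc_bound) (use True right_Re in \<open>auto intro!: mult_left_mono_neg\<close>)
    moreover have "max 0 (1 - exp (- u)) = 0" using True by simp
    ultimately show ?thesis by (simp only: seg_eq of_real_0 mult_zero_right diff_zero)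
  next
    case False
    have "norm (contour_integral ?left ?f) \<le> E"
      by (rule arc_bound) (use False left_Re in \<open>auto intro!: mult_left_mono\<close>)
    \<comment> \<open>Partial fractions 1/s - 1/(s + 1) reduce the full circle to two Cauchy
      integrals, with residues 1 and -exp(-u).\<close>
    moreover have "contour_integral ?right ?f + contour_integral ?left ?f = 2 * of_real pi * \<i> * (1 - exp (- of_real u))"
    proof -
      let ?g = "\<lambda>s. exp (of_real u * s)"
      have "norm (0 - ?c) < R" "norm (-1 - ?c) < R"
        using \<sigma> R norm_of_real[of "\<sigma> + 1", where ?'a = complex] norm_minus_cancel[of "of_real (\<sigma> + 1) :: complex"]
        by (auto simp: algebra_simps)
      then have "((\<lambda>s. ?g s / (s - 0)) has_contour_integral (2 * of_real pi * \<i> * ?g 0)) (circlepath ?c R)"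
           "((\<lambda>s. ?g s / (s - (-1))) has_contour_integral (2 * of_real pi * \<i> * ?g (-1))) (circlepath ?c R)"
        by (intro Cauchy_integral_circlepath_simple holomorphic_intros; simp)+
      from has_contour_integral_diff[OF this]
      have 1: "((\<lambda>s. ?g s / (s - 0) - ?g s / (s - (-1))) has_contour_integral 2 * of_real pi * \<i> * (1 - exp (- of_real u))) (circlepath ?c R)"
        by (simp add: algebra_simps)
      have "(?f has_contour_integral 2 * of_real pi * \<i> * (1 - exp (- of_real u))) (circlepath ?c R)"
      proof (rule has_contour_integral_eq[OF 1])
        fix s assume "s \<in> path_image (circlepath ?c R)"
        then have "norm (s - ?c) = R" using R0 by (auto simp: dist_norm norm_minus_commute)
        then have "s \<noteq> 0" "s + 1 \<noteq> 0" using far[of s] R0 by auto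
        then show "?g s / (s - 0) - ?g s / (s - (-1)) = ?f s"
          by (simp add: perron_kernel_def field_simps)
      qed
      then have "contour_integral (circlepath ?c R) ?f = 2 * of_real pi * \<i> * (1 - exp (- of_real u))"
        by (rule contour_integral_unique)
      moreover have "contour_integral (circlepath ?c R) ?f = contour_integral ?right ?f + contour_integral ?left ?f"
      proof -
        define h where "h = (\<lambda>t. ?f (?c + of_real R * cis t) * of_real R * \<i> * cis t)"
        have arc: "contour_integral (part_circlepath ?c R a b) ?f = integral {a..b} h" if "a < b" for a b
          using contour_integral_part_circlepath_eq[OF that, of ?c R ?f] by (simp add: h_def)
        have "continuous_on UNIV (\<lambda>t. ?f (?c + of_real R * cis t))"
        proof (rule continuous_on_compose2[OF holomorphic_on_imp_continuous_on[OF hol]])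
          show "range (\<lambda>t. ?c + of_real R * cis t) \<subseteq> - {0, -1}"
          proof
            fix s assume "s \<in> range (\<lambda>t. ?c + of_real R * cis t)"
            then have n: "norm (s - ?c) = R" using R0 by (auto simp: norm_mult)
            from far[OF n] R0 show "s \<in> - {0, -1}" by auto
          qed
        qed (auto intro!: continuous_intros)
        then have cont: "continuous_on UNIV h"
          unfolding h_def by (intro continuous_intros)
        have I: "h integrable_on {a..b}" for a b
          using continuous_on_subset[OF cont] by (intro integrable_continuous_real) auto
        \<comment> \<open>\<open>circlepath\<close> runs over [0, 2 pi] while the right arc begins
          at -pi/2; periodicity moves that quarter to the end.\<close>
        have per: "integral {-pi/2..0} h = integral {3*pi/2..2*pi} h"
        proof -
          have "h \<circ> (\<lambda>x. x + 2 * pi) = h" by (auto simp: h_def fun_eq_iff cis.code)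
          then have "integral {-pi/2..0} h = integral {-pi/2..0} (h \<circ> (\<lambda>x. x + 2 * pi))" by simp
          also have "\<dots> = integral {-pi/2 + 2 * pi..0 + 2 * pi} h"
            using continuous_on_subset[OF cont] by (intro integral_shift) auto
          finally show ?thesis by simp
        qed
        have split: "integral {-pi/2..0} h + integral {0..pi/2} h = integral {-pi/2..pi/2} h"
             "integral {0..pi/2} h + integral {pi/2..2*pi} h = integral {0..2*pi} h"
             "integral {pi/2..3*pi/2} h + integral {3*pi/2..2*pi} h = integral {pi/2..2*pi} h"
          by (intro Henstock_Kurzweil_Integration.integral_combine I; use pi_gt_zero in simp)+
        have "integral {0..2*pi} h = integral {-pi/2..pi/2} h + integral {pi/2..3*pi/2} h"
          unfolding split[symmetric] per by (simp only: add_ac)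
        then show ?thesis
          unfolding circlepath_def by (subst (1 2 3) arc) (use pi_gt_zero in simp_all)
      qed
      ultimately show ?thesis by simp
    qed
    ultimately show ?thesis using False
      by (simp add: seg_eq max_def exp_of_real flip: of_real_minus) (smt (verit) add_diff_cancel_left' norm_minus_commute)
  qed
qed

text \<open>The exponent is 1/2 - 2, the growth of F'' against the decay of the kernel. The bound is
  independent of R, so the height of the segment can tend to infinity.\<close>

lemma integral_decay_le:
  assumes "R > 0"
  shows "(\<lambda>t. (1 + \<bar>t\<bar>) powr (-(3/2))) integrable_on {-R..R}"
    "integral {-R..R} (\<lambda>t. (1 + \<bar>t\<bar>) powr (-(3/2))) \<le> (4 :: real)"
proof -
  let ?f = "\<lambda>t::real. (1 + \<bar>t\<bar>) powr (-(3/2))"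
  have pos: "((\<lambda>t. (1 + t) powr (-(3/2))) has_integral - 2 * (1 + R) powr (-(1/2)) - (- 2 * (1 + 0) powr (-(1/2)))) {0..R}"
    using assms
    by (intro fundamental_theorem_of_calculus)
       (auto intro!: derivative_eq_intros simp flip: has_real_derivative_iff_has_vector_derivative)
  then have 1: "(?f has_integral 2 - 2 * (1 + R) powr (-(1/2))) {0..R}"
    by (subst has_integral_cong[where g = "\<lambda>t. (1 + t) powr (-(3/2))"]) auto
  then have 2: "(?f has_integral 2 - 2 * (1 + R) powr (-(1/2))) {-R..0}"
    using has_integral_reflect_real[of ?f _ R 0] by simp
  have 3: "(?f has_integral (2 - 2 * (1 + R) powr (-(1/2))) + (2 - 2 * (1 + R) powr (-(1/2)))) {-R..R}"
    using assms by (intro has_integral_combine[OF _ _ 2 1]) auto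
  show "?f integrable_on {-R..R}" using 3 by blast
  show "integral {-R..R} ?f \<le> 4" using 3 by (auto dest!: integral_unique)
qed

lemma norm_s_times_s1_ge:
  assumes "\<sigma> \<ge> 1"
  shows "norm (Complex \<sigma> t * (Complex \<sigma> t + 1)) \<ge> (1 + \<bar>t\<bar>) ^ 2 / 2" "norm (Complex \<sigma> t * (Complex \<sigma> t + 1)) \<ge> 1"
proof -
  let ?s = "Complex \<sigma> t"
  have "norm ?s \<le> norm (?s + 1)"
    unfolding norm_complex_def using assms by (intro real_sqrt_le_mono) (auto intro!: power_mono)
  then have "norm ?s * norm ?s \<le> norm ?s * norm (?s + 1)" by (intro mult_left_mono) auto
  moreover have "norm ?s * norm ?s = \<sigma>\<^sup>2 + t\<^sup>2"
    by (simp add: cmod_power2 flip: power2_eq_square)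
  moreover have "\<sigma>\<^sup>2 \<ge> 1" using assms by simp
  moreover have "(1 + \<bar>t\<bar>) ^ 2 / 2 \<le> 1 + t\<^sup>2"
    using sum_squares_bound[of 1 "\<bar>t\<bar>"] by (simp add: power2_eq_square algebra_simps)
  moreover have "t\<^sup>2 \<ge> 0" by simp
  ultimately show "norm (?s * (?s + 1)) \<ge> (1 + \<bar>t\<bar>) ^ 2 / 2" "norm (?s * (?s + 1)) \<ge> 1"
    unfolding norm_mult by linarith+
qed

lemma perron_kernel_ln:
  assumes "y > 0" "n > (0::nat)"
  shows "perron_kernel (ln (y / real n)) s = exp (of_real (ln y) * s) / (s * (s + 1)) * of_nat n powr (-s)"
  using assms
  by (simp add: perron_kernel_def ln_div powr_def Ln_of_nat algebra_simps exp_diff exp_minus field_simps)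

text \<open>Uniform convergence on the segment allows termwise integration, and the truncation
  errors of \<open>perron_kernel_integral\<close> add up to an absolutely convergent series. The
  condition on \<open>a 0\<close> is needed because \<open>0 powr z = 0\<close> hides index 0 from
  the Dirichlet series, whereas the Cesaro sum counts it.\<close>

lemma cesaro_sum_contour_bound:
  assumes a: "abs_conv a" and y: "y > 0" and \<sigma>: "\<sigma> > 1" and R: "R \<ge> 2 * \<sigma> + 2"
    and a0: "a 0 = 0"
  defines "G \<equiv> (\<lambda>s. exp (of_real (ln y) * s) / (s * (s + 1)) * dirichlet a s)"
  shows "norm (contour_integral (linepath (Complex \<sigma> (-R)) (Complex \<sigma> R)) G
            - 2 * of_real pi * \<i> * of_real (\<Sum>n | real n \<le> y. a n * (1 - real n / y)))
          \<le> y powr \<sigma> * (4 * pi / R) * (\<Sum>n. \<bar>a n\<bar> * real n powr (-\<sigma>))"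
proof -
  let ?L = "linepath (Complex \<sigma> (-R)) (Complex \<sigma> R)"
  have Re_L: "Re s = \<sigma>" if "s \<in> path_image ?L" for s
  proof -
    from that obtain v where v: "s = (1 - v) *\<^sub>R Complex \<sigma> (-R) + v *\<^sub>R Complex \<sigma> R"
      by (auto simp: closed_segment_def)
    show ?thesis unfolding v by (simp add: algebra_simps)
  qed
  have L_eq: "s = Complex \<sigma> (Im s)" if "s \<in> path_image ?L" for s
    using Re_L[OF that] by (simp add: complex_eq_iff)
  define g where "g = (\<lambda>n (s :: complex). exp (of_real (ln y) * s) / (s * (s + 1)) * (of_real (a n) * of_nat n powr (-s)))"
  have g_eq: "g n s = of_real (a n) * perron_kernel (ln (y / real n)) s" for n and s :: complex
    using perron_kernel_ln[OF y] a0 by (cases "n = 0") (auto simp: g_def)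
  define M where "M = (\<lambda>n. \<bar>a n\<bar> * real n powr (-\<sigma>))"
  have M: "summable M" using a \<sigma> by (auto simp: M_def abs_conv_def)
  have norm_exp: "norm (exp (of_real (ln y) * s)) = y powr \<sigma>" if "Re s = \<sigma>" for s
    using y that by (simp add: powr_def mult.commute)
  have bound: "norm (g n s) \<le> y powr \<sigma> * M n" if s: "s \<in> path_image ?L" for n s
  proof -
    have "norm (s * (s + 1)) \<ge> 1" using norm_s_times_s1_ge(2)[of \<sigma> "Im s"] \<sigma> L_eq[OF s] by simp
    then have "norm (exp (of_real (ln y) * s)) / norm (s * (s + 1)) \<le> y powr \<sigma> / 1"
      using norm_exp[OF Re_L[OF s]] by (intro frac_le) auto
    moreover have "norm (of_real (a n) * of_nat n powr (-s) :: complex) = M n"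
      using Re_L[OF s] by (simp add: M_def norm_mult norm_nat_powr)
    moreover have "M n \<ge> 0" by (simp add: M_def)
    ultimately show ?thesis
      unfolding g_def norm_mult[of "_ / _"] norm_divide by (intro mult_mono) auto
  qed
  have G_eq: "(\<Sum>n. g n s) = G s" if s: "s \<in> path_image ?L" for s
  proof -
    have "summable (\<lambda>n. of_real (a n) * of_nat n powr (-s) :: complex)"
      by (rule summable_norm_cancel, rule abs_conv_summable_norm[OF a]) (use Re_L[OF s] \<sigma> in simp)
    then show ?thesis unfolding g_def G_def dirichlet_def by (rule suminf_mult)
  qed
  have hol: "g n holomorphic_on {s. Re s > 0}" for n
  proof (cases "n = 0")
    case False
    then show ?thesis unfolding g_def[abs_def]
      by (intro holomorphic_intros) (auto simp: eq_neg_iff_add_eq_0[symmetric])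
  qed (simp add: g_def[abs_def])
  have int: "g n contour_integrable_on ?L" for n
    by (intro contour_integrable_continuous_linepath holomorphic_on_imp_continuous_on
              holomorphic_on_subset[OF hol]) (use Re_L \<sigma> in fastforce)
  have "uniform_limit (path_image ?L) (\<lambda>N s. \<Sum>n<N. g n s) (\<lambda>s. \<Sum>n. g n s) sequentially"
    by (rule Weierstrass_m_test, erule bound) (intro summable_mult M)
  then have UL: "uniform_limit (path_image ?L) (\<lambda>N s. \<Sum>n<N. g n s) G sequentially"
    by (rule uniform_limit_cong'[THEN iffD1, rotated -1]) (auto simp: G_eq simp del: path_image_linepath)
  have "(\<lambda>N. contour_integral ?L (\<lambda>s. \<Sum>n<N. g n s)) \<longlonglongrightarrow> contour_integral ?L G"
    by (rule contour_integral_uniform_limit[OF _ UL, where B = "norm (Complex \<sigma> R - Complex \<sigma> (-R))"])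
       (auto intro!: contour_integrable_sum int always_eventually)
  then have sums: "(\<lambda>n. contour_integral ?L (g n)) sums contour_integral ?L G"
    unfolding sums_def by (subst (asm) contour_integral_sum) (auto intro: int)
  define h where "h = (\<lambda>n. a n * max 0 (1 - real n / y))"
  have fin: "finite {n. real n \<le> y}"
    by (rule finite_subset[of _ "{..nat \<lceil>y\<rceil>}"]) (auto simp: le_nat_iff; linarith)+
  have "h sums (\<Sum>n | real n \<le> y. h n)"
    using fin by (intro sums_finite) (use y in \<open>auto simp: h_def max_def field_simps\<close>)
  also have "(\<Sum>n | real n \<le> y. h n) = (\<Sum>n | real n \<le> y. a n * (1 - real n / y))"
    using y by (intro sum.cong) (auto simp: h_def max_def field_simps)
  finally have h: "h sums (\<Sum>n | real n \<le> y. a n * (1 - real n / y))" .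
  have D: "(\<lambda>n. contour_integral ?L (g n) - 2 * of_real pi * \<i> * of_real (h n)) sums
     (contour_integral ?L G - 2 * of_real pi * \<i> * of_real (\<Sum>n | real n \<le> y. a n * (1 - real n / y)))"
    by (intro sums_diff sums sums_mult sums_of_real h)
  have diff: "norm (contour_integral ?L (g n) - 2 * of_real pi * \<i> * of_real (h n)) \<le> y powr \<sigma> * (4 * pi / R) * M n" for n
  proof (cases "n = 0")
    case True
    then show ?thesis using a0 by (simp add: g_def[abs_def] h_def M_def)
  next
    case False
    define u where "u = ln (y / real n)"
    have eu: "exp (-u) = real n / y" using y False by (simp add: u_def exp_minus)
    have eu\<sigma>: "exp (u * \<sigma>) = y powr \<sigma> * real n powr (-\<sigma>)"
      using y False by (simp add: u_def powr_def ln_div algebra_simps flip: exp_add)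
    have "contour_integral ?L (g n) - 2 * of_real pi * \<i> * of_real (h n)
        = of_real (a n) * (contour_integral ?L (perron_kernel u) - 2 * of_real pi * \<i> * of_real (max 0 (1 - exp (-u))))"
    proof -
      have "contour_integral ?L (g n) = of_real (a n) * contour_integral ?L (perron_kernel u)"
      proof (cases "a n = 0")
        case False
        have "perron_kernel u = (\<lambda>s. inverse (of_real (a n)) * g n s)"
          using False by (auto simp: g_eq u_def)
        then have "perron_kernel u contour_integrable_on ?L"
          using int by (simp add: contour_integrable_lmul)
        then show ?thesis by (subst contour_integral_lmul[symmetric]) (auto simp: g_eq[abs_def] u_def)
      qed (simp add: g_eq[abs_def])
      then show ?thesis by (simp add: h_def eu algebra_simps)
    qed
    also have "norm \<dots> \<le> \<bar>a n\<bar> * (exp (u * \<sigma>) * (4 * pi / R))"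
      unfolding norm_mult norm_of_real using \<sigma> R by (intro mult_left_mono perron_kernel_integral) auto
    finally show ?thesis unfolding eu\<sigma> M_def by (simp add: mult_ac)
  qed
  have "norm (contour_integral ?L G - 2 * of_real pi * \<i> * of_real (\<Sum>n | real n \<le> y. a n * (1 - real n / y)))
     \<le> (\<Sum>n. y powr \<sigma> * (4 * pi / R) * M n)"
    unfolding sums_unique[OF D]
    by (intro norm_suminf_le diff summable_mult M)
  also have "\<dots> = y powr \<sigma> * (4 * pi / R) * (\<Sum>n. M n)" by (intro suminf_mult M)
  finally show ?thesis by (simp add: M_def)
qed

text \<open>The limit R -> infinity at fixed y and \<sigma> removes the truncation error B / R,
  whose size depends on \<sigma>. The remaining constant does not, so \<sigma> may later be tied to
  y.\<close>

lemma cesaro_sum_bound: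
  obtains C where "C > 0"
    "\<And>y \<sigma>. y > 0 \<Longrightarrow> 1 < \<sigma> \<Longrightarrow> \<sigma> \<le> 2 \<Longrightarrow> \<bar>\<Sum>n | real n \<le> y. psi_coeff n * (y - real n)\<bar> \<le> C * y powr (\<sigma> + 1)"
proof -
  obtain C where C: "C > 0"
    "\<And>s. 1 < Re s \<Longrightarrow> Re s \<le> 2 \<Longrightarrow> norm (dirichlet psi_coeff s) \<le> C * (1 + \<bar>Im s\<bar>) powr (1/2)"
    using dirichlet_psi_coeff_bound by blast
  show ?thesis
  \<comment> \<open>8 is 2 * 4: the 2 comes from |s (s + 1)| \<ge> (1 + |t|)^2 / 2, the 4 from
    \<open>integral_decay_le\<close>.\<close>
  proof (rule that[of "8 * C / (2 * pi)"])
    fix y \<sigma> :: real assume y: "y > 0" and \<sigma>: "1 < \<sigma>" "\<sigma> \<le> 2"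
    define G where "G = (\<lambda>s. exp (of_real (ln y) * s) / (s * (s + 1)) * dirichlet psi_coeff s)"
    define S where "S = (\<Sum>n | real n \<le> y. psi_coeff n * (1 - real n / y))"
    define B where "B = y powr \<sigma> * (4 * pi) * (\<Sum>n. \<bar>psi_coeff n\<bar> * real n powr (-\<sigma>))"
    have main: "2 * pi * \<bar>S\<bar> \<le> 8 * C * y powr \<sigma> + B / R" if R: "R \<ge> 2 * \<sigma> + 2" for R
    proof -
      let ?L = "linepath (Complex \<sigma> (-R)) (Complex \<sigma> R)"
      have R0: "R > 0" using R \<sigma> by linarith
      have "norm (contour_integral ?L G - 2 * of_real pi * \<i> * of_real S) \<le> y powr \<sigma> * (4 * pi / R) * (\<Sum>n. \<bar>psi_coeff n\<bar> * real n powr (-\<sigma>))"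
        unfolding G_def S_def
        by (rule cesaro_sum_contour_bound[OF abs_conv_psi_coeff y \<sigma>(1) R]) (simp add: psi_coeff_def)
      then have 1: "norm (contour_integral ?L G - 2 * of_real pi * \<i> * of_real S) \<le> B / R"
        by (simp add: B_def)
      have "norm (contour_integral ?L G) = norm (integral {-R..R} (\<lambda>t. G (Complex \<sigma> t)))"
        by (subst contour_integral_linepath_same_Re[of _ \<sigma> _ "-R" R]) (use R0 in \<open>auto simp: norm_mult\<close>)
      also have "\<dots> \<le> integral {-R..R} (\<lambda>t. 2 * C * y powr \<sigma> * (1 + \<bar>t\<bar>) powr (-(3/2)))"
      proof (rule integral_norm_bound_integral)
        have "continuous_on {s. Re s > 1} G" unfolding G_def
          by (intro holomorphic_on_imp_continuous_on holomorphic_intros holomorphic_dirichlet abs_conv_psi_coeff)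
             (auto simp: eq_neg_iff_add_eq_0[symmetric])
        then have "continuous_on {-R..R} (\<lambda>t. G (Complex \<sigma> t))"
          by (rule continuous_on_compose2) (use \<sigma> in \<open>auto simp: Complex_eq intro!: continuous_intros\<close>)
        then show "(\<lambda>t. G (Complex \<sigma> t)) integrable_on {-R..R}" by (rule integrable_continuous_real)
        show "(\<lambda>t. 2 * C * y powr \<sigma> * (1 + \<bar>t\<bar>) powr (-(3/2))) integrable_on {-R..R}"
          using integrable_on_cmult_left[OF integral_decay_le(1)[OF R0]] by simp
        fix t assume "t \<in> {-R..R}"
        let ?s = "Complex \<sigma> t"
        have "norm (exp (of_real (ln y) * ?s)) = y powr \<sigma>" using y by (simp add: powr_def mult.commute)
        then have "norm (G ?s) = y powr \<sigma> / norm (?s * (?s + 1)) * norm (dirichlet psi_coeff ?s)"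
          by (simp add: G_def norm_mult norm_divide)
        also have "\<dots> \<le> y powr \<sigma> / ((1 + \<bar>t\<bar>) ^ 2 / 2) * (C * (1 + \<bar>t\<bar>) powr (1/2))"
          using C(2)[of ?s] \<sigma> norm_s_times_s1_ge(1)[of \<sigma> t] by (intro mult_mono frac_le) auto
        also have "\<dots> = 2 * C * y powr \<sigma> * ((1 + \<bar>t\<bar>) powr (1/2) / (1 + \<bar>t\<bar>) ^ 2)" by simp
        also have "(1 + \<bar>t\<bar>) powr (1/2) / (1 + \<bar>t\<bar>) ^ 2 = (1 + \<bar>t\<bar>) powr (-(3/2))"
          using powr_diff[of "1 + \<bar>t\<bar>" "1/2" 2] by simp
        finally show "norm (G ?s) \<le> 2 * C * y powr \<sigma> * (1 + \<bar>t\<bar>) powr (-(3/2))" .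
      qed
      also have "\<dots> = 2 * C * y powr \<sigma> * integral {-R..R} (\<lambda>t. (1 + \<bar>t\<bar>) powr (-(3/2)))" by simp
      also have "\<dots> \<le> 2 * C * y powr \<sigma> * 4"
        using C integral_decay_le(2)[OF R0] by (intro mult_left_mono) auto
      finally have "norm (contour_integral ?L G) \<le> 8 * C * y powr \<sigma>" by simp
      moreover have "2 * pi * \<bar>S\<bar> = norm (2 * of_real pi * \<i> * of_real S)" by (simp add: norm_mult)
      moreover have "norm (2 * of_real pi * \<i> * of_real S) \<le> norm (contour_integral ?L G) + norm (contour_integral ?L G - 2 * of_real pi * \<i> * of_real S)"
        by (metis add.commute norm_minus_commute norm_triangle_sub)
      ultimately show ?thesis using 1 by linarith
    qed
    have "2 * pi * \<bar>S\<bar> \<le> 8 * C * y powr \<sigma> + 0"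
    proof (rule tendsto_lowerbound)
      show "((\<lambda>R. 8 * C * y powr \<sigma> + B / R) \<longlongrightarrow> 8 * C * y powr \<sigma> + 0) at_top"
        by (intro tendsto_intros tendsto_divide_0[OF tendsto_const] filterlim_at_top_imp_at_infinity filterlim_ident)
      show "\<forall>\<^sub>F R in at_top. 2 * pi * \<bar>S\<bar> \<le> 8 * C * y powr \<sigma> + B / R"
        using eventually_ge_at_top[of "2 * \<sigma> + 2"] by eventually_elim (rule main)
    qed auto
    then have "\<bar>S\<bar> \<le> 8 * C / (2 * pi) * y powr \<sigma>"
      using pi_gt_zero by (simp add: field_simps)
    then have "y * \<bar>S\<bar> \<le> y * (8 * C / (2 * pi) * y powr \<sigma>)" using y by (intro mult_left_mono) auto
    moreover have "(\<Sum>n | real n \<le> y. psi_coeff n * (y - real n)) = y * S"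
      unfolding S_def sum_distrib_left using y by (intro sum.cong) (auto simp: field_simps)
    ultimately show "\<bar>\<Sum>n | real n \<le> y. psi_coeff n * (y - real n)\<bar> \<le> 8 * C / (2 * pi) * y powr (\<sigma> + 1)"
      using y by (simp add: abs_mult powr_add mult_ac)
  qed (use C in auto)
qed

section \<open>From Cesaro sums to sums\<close>

lemma finite_nat_le_real: "finite {n::nat. real n \<le> x}"
  by (rule finite_subset[of _ "{..nat \<lfloor>x\<rfloor>}"]) (auto simp: le_nat_floor)

lemma card_nat_Ioc_le:
  assumes "h \<ge> 0"
  shows "real (card {n::nat. x < real n \<and> real n \<le> x + h}) \<le> h + 1"
proof -
  have "{n::nat. x < real n \<and> real n \<le> x + h} \<subseteq> nat ` {\<lfloor>x\<rfloor><..\<lfloor>x + h\<rfloor>}"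
  proof
    fix n :: nat assume "n \<in> {n. x < real n \<and> real n \<le> x + h}"
    then have "int n \<in> {\<lfloor>x\<rfloor><..\<lfloor>x + h\<rfloor>}" by (simp add: floor_less_iff le_floor_iff)
    then show "n \<in> nat ` {\<lfloor>x\<rfloor><..\<lfloor>x + h\<rfloor>}" by (metis image_eqI nat_int)
  qed
  then have "card {n::nat. x < real n \<and> real n \<le> x + h} \<le> card {\<lfloor>x\<rfloor><..\<lfloor>x + h\<rfloor>}"
    by (meson card_image_le card_mono finite_greaterThanAtMost_int finite_imageI le_trans)
  also have "\<dots> = nat (\<lfloor>x + h\<rfloor> - \<lfloor>x\<rfloor>)" by simp
  finally have "real (card {n::nat. x < real n \<and> real n \<le> x + h}) \<le> real (nat (\<lfloor>x + h\<rfloor> - \<lfloor>x\<rfloor>))" by linarith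
  also have "\<dots> = real_of_int (\<lfloor>x + h\<rfloor> - \<lfloor>x\<rfloor>)" using assms by (simp add: floor_mono)
  also have "\<dots> \<le> h + 1" by linarith
  finally show ?thesis .
qed

lemma sum_weight_ge:
  fixes a w :: "nat \<Rightarrow> real"
  assumes "h \<ge> 0" "V \<ge> 0"
    "\<And>n. x < real n \<Longrightarrow> real n \<le> x + h \<Longrightarrow> a n \<ge> -V \<and> 0 \<le> w n \<and> w n \<le> h"
  shows "(\<Sum>n | x < real n \<and> real n \<le> x + h. a n * w n) \<ge> - (V * h * (h + 1))"
proof -
  let ?A = "{n. x < real n \<and> real n \<le> x + h}"
  have "- (V * h * (h + 1)) \<le> - (V * h * real (card ?A))"
    using card_nat_Ioc_le[OF assms(1), of x] assms by (intro le_imp_neg_le mult_left_mono) auto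
  also have "\<dots> = (\<Sum>n\<in>?A. - (V * h))" by simp
  also have "\<dots> \<le> (\<Sum>n\<in>?A. a n * w n)"
  proof (rule sum_mono)
    fix n assume "n \<in> ?A"
    then have n: "a n \<ge> -V" "0 \<le> w n" "w n \<le> h" using assms(3) by auto
    have "- V * w n \<le> a n * w n" using n by (intro mult_right_mono)
    moreover have "V * w n \<le> V * h" using n assms by (intro mult_left_mono)
    ultimately show "- (V * h) \<le> a n * w n" by linarith
  qed
  finally show ?thesis .
qed

text \<open>A one-sided Tauberian step. S(x + h) - S(x) is h times the sum plus a weighted sum over
  (x, x + h], and S(x) - S(x - h) is h times the sum minus one over (x - h, x]. The lower bound -V
  on the coefficients therefore limits the sum from above in the first case and from below in the
  second.\<close>

lemma sum_from_cesaro: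
  fixes a :: "nat \<Rightarrow> real"
  defines "S \<equiv> \<lambda>x. \<Sum>n | real n \<le> x. a n * (x - real n)"
  assumes h: "h > 0" and V: "V \<ge> 0" "\<And>n. real n \<le> x + h \<Longrightarrow> a n \<ge> -V"
    and B: "\<bar>S x\<bar> \<le> B" "\<bar>S (x + h)\<bar> \<le> B" "\<bar>S (x - h)\<bar> \<le> B"
  shows "\<bar>\<Sum>n | real n \<le> x. a n\<bar> \<le> 2 * B / h + V * (h + 1)"
proof -
  define A where "A = (\<Sum>n | real n \<le> x. a n)"
  have decomp: "(\<Sum>n | real n \<le> x + h. f n) = (\<Sum>n | real n \<le> x. f n) + (\<Sum>n | x < real n \<and> real n \<le> x + h. f n)"
    if "h \<ge> 0" for f :: "nat \<Rightarrow> real" and x h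
  proof -
    have "{n. real n \<le> x + h} = {n. real n \<le> x} \<union> {n. x < real n \<and> real n \<le> x + h}" using that by auto
    then show ?thesis
      by (simp only:) (intro sum.union_disjoint; auto intro: finite_subset[OF _ finite_nat_le_real[of "x + h"]] simp: finite_nat_le_real)
  qed
  have "S (x + h) - S x = h * A + (\<Sum>n | x < real n \<and> real n \<le> x + h. a n * (x + h - real n))"
    unfolding S_def A_def using h by (subst decomp) (simp_all add: sum_distrib_left algebra_simps flip: sum.distrib sum_subtractf)
  moreover have "(\<Sum>n | x < real n \<and> real n \<le> x + h. a n * (x + h - real n)) \<ge> - (V * h * (h + 1))"
    using h V by (intro sum_weight_ge) auto
  ultimately have up: "h * A \<le> 2 * B + V * h * (h + 1)" using B by linarith
  have "S x - S (x - h) = h * A - (\<Sum>n | x - h < real n \<and> real n \<le> x. a n * (real n - (x - h)))"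
    using h decomp[of h _ "x - h"] unfolding S_def A_def
    by (simp add: sum_distrib_left algebra_simps flip: sum.distrib sum_subtractf)
  moreover have "(\<Sum>n | x - h < real n \<and> real n \<le> x - h + h. a n * (real n - (x - h))) \<ge> - (V * h * (h + 1))"
    using h V by (intro sum_weight_ge) auto
  ultimately have "h * A \<ge> - (2 * B + V * h * (h + 1))" using B by simp
  with up have "\<bar>h * A\<bar> \<le> 2 * B + V * h * (h + 1)" by linarith
  then show ?thesis using h by (simp add: A_def abs_mult field_simps)
qed

section \<open>Comparison of logarithms with powers\<close>

lemma ln_ge_1: "x \<ge> 3 \<Longrightarrow> ln x \<ge> (1 :: real)"
  using exp_le by (subst ln_ge_iff) auto

lemma ln_le_two_sqrt: "x \<ge> 1 \<Longrightarrow> ln x \<le> 2 * sqrt (x::real)"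
  using ln_powr_bound[of x "1/2"] by (simp add: powr_half_sqrt)

lemma ln_le_self: "x \<ge> 1 \<Longrightarrow> ln x \<le> (x::real)"
  using ln_le_minus_one[of x] by simp

lemma sqrt_le_quotient_ln:
  assumes "x \<ge> (3::real)"
  shows "sqrt x \<le> 2 * (x / ln x)"
proof -
  have "sqrt x * ln x \<le> sqrt x * (2 * sqrt x)" using assms by (intro mult_left_mono ln_le_two_sqrt) auto
  also have "\<dots> = 2 * x" using assms by simp
  finally show ?thesis using ln_ge_1[OF assms] by (simp add: pos_le_divide_eq)
qed

lemma ln_squared_le: "x \<ge> 1 \<Longrightarrow> ln x ^ 2 \<le> 4 * (x::real)"
  using power_mono[OF ln_le_two_sqrt[of x], of 2] by (simp add: power_mult_distrib)

lemma psi_coeff_ge: "psi_coeff n \<ge> - (ln (real n) ^ 2)"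
  using mangoldt_nonneg[of n] unfolding psi_coeff_eq by simp

lemma psi_coeff_sum_bound:
  obtains C where "C > 0" "\<And>x. x \<ge> 3 \<Longrightarrow> \<bar>\<Sum>n | real n \<le> x. psi_coeff n\<bar> \<le> C * (x * ln x)"
proof -
  obtain C where C: "C > 0"
    "\<And>y \<sigma>. y > 0 \<Longrightarrow> 1 < \<sigma> \<Longrightarrow> \<sigma> \<le> 2 \<Longrightarrow> \<bar>\<Sum>n | real n \<le> y. psi_coeff n * (y - real n)\<bar> \<le> C * y powr (\<sigma> + 1)"
    using cesaro_sum_bound by blast
  show ?thesis
  proof (rule that[of "48 * C + 8"])
    show "48 * C + 8 > 0" using C by simp
    fix x :: real assume x: "x \<ge> 3"
    \<comment> \<open>This step balances the two errors: x^2 / h and h ln^2 x both become x ln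
      x.\<close>
    define h where "h = x / ln x"
    note l1 = ln_ge_1[OF x]
    have h: "h > 0" "h \<le> x" "h \<ge> 1" using x l1 ln_le_self[of x] by (auto simp: h_def field_simps)
    \<comment> \<open>Here x^(\<sigma> - 1) = e, so approaching Re s = 1 costs only a constant
      factor.\<close>
    define \<sigma> where "\<sigma> = 1 + 1 / ln x"
    have \<sigma>: "1 < \<sigma>" "\<sigma> \<le> 2" using l1 by (auto simp: \<sigma>_def field_simps)
    have B: "\<bar>\<Sum>n | real n \<le> y. psi_coeff n * (y - real n)\<bar> \<le> 24 * C * x ^ 2" if y: "0 \<le> y" "y \<le> 2 * x" for y
    proof (cases "y = 0")
      case False
      have "\<bar>\<Sum>n | real n \<le> y. psi_coeff n * (y - real n)\<bar> \<le> C * y powr (\<sigma> + 1)"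
        using C(2)[of y \<sigma>] \<sigma> y False by auto
      also have "\<dots> \<le> C * (2 * x) powr (\<sigma> + 1)"
        using C y \<sigma> by (intro mult_left_mono powr_mono2) auto
      also have "(2 * x) powr (\<sigma> + 1) = (2 * x) ^ 2 * (2 powr (1 / ln x) * x powr (1 / ln x))"
      proof -
        have "(2 * x) powr (\<sigma> + 1) = (2 * x) powr 2 * (2 * x) powr (1 / ln x)"
          by (simp add: \<sigma>_def flip: powr_add)
        moreover have "(2 * x) powr (1 / ln x) = 2 powr (1 / ln x) * x powr (1 / ln x)"
          using x by (subst powr_mult) auto
        moreover have "(2 * x) powr 2 = (2 * x) ^ 2" using x by (subst powr_numeral) auto
        ultimately show ?thesis by simp
      qed
      also have "x powr (1 / ln x) = exp 1" using x l1 by (simp add: powr_def)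
      also have "C * ((2 * x) ^ 2 * (2 powr (1 / ln x) * exp 1)) \<le> C * ((2 * x) ^ 2 * (2 * 3))"
        using C exp_le powr_mono[of "1 / ln x" 1 2] l1 by (intro mult_left_mono mult_mono) auto
      finally show ?thesis by (simp add: power2_eq_square)
    next
      case True
      then have "{n::nat. real n \<le> y} = {0}" by auto
      then show ?thesis using True C by simp
    qed
    \<comment> \<open>All n concerned are at most x + h \<le> 2 x, and \<open>psi_coeff n\<close> is
      at least - ln^2 n.\<close>
    define V where "V = ln (2 * x) ^ 2"
    have "\<bar>\<Sum>n | real n \<le> x. psi_coeff n\<bar> \<le> 2 * (24 * C * x ^ 2) / h + V * (h + 1)"
    proof (rule sum_from_cesaro[OF h(1)])
      fix n :: nat assume n: "real n \<le> x + h"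
      have "ln (real n) ^ 2 \<le> V"
      proof (cases "n = 0")
        case False
        then show ?thesis unfolding V_def using n h by (intro power_mono) auto
      qed (auto simp: V_def)
      then show "- V \<le> psi_coeff n" using psi_coeff_ge[of n] by linarith
    qed (use B[of x] B[of "x + h"] B[of "x - h"] h x in \<open>auto simp: V_def\<close>)
    also have "2 * (24 * C * x ^ 2) / h = 48 * C * (x * ln x)"
      using x l1 by (simp add: h_def power2_eq_square)
    also have "V * (h + 1) \<le> (2 * ln x) ^ 2 * (2 * h)"
    proof (intro mult_mono)
      have "ln (2 * x) \<le> 2 * ln x" using x by (simp add: ln_mult)
      then show "V \<le> (2 * ln x) ^ 2" unfolding V_def using x by (intro power_mono) auto
    qed (use h in auto)
    also have "(2 * ln x) ^ 2 * (2 * h) = 8 * (x * ln x)"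
      using l1 by (simp add: h_def power2_eq_square)
    finally show "\<bar>\<Sum>n | real n \<le> x. psi_coeff n\<bar> \<le> (48 * C + 8) * (x * ln x)"
      by (simp add: algebra_simps)
  qed
qed

lemma ln_quotient_le_sum_inverse:
  assumes "n > 0" "real n \<le> x"
  shows "ln (x / real n) \<le> (\<Sum>m | n \<le> m \<and> real m \<le> x. 1 / real m)"
proof -
  define N where "N = nat \<lfloor>x\<rfloor>"
  have N: "n \<le> N" "x < real N + 1" using assms by (auto simp: N_def le_nat_floor)
  have set_eq: "{m. n \<le> m \<and> real m \<le> x} = {n..<Suc N}"
    using assms unfolding N_def by (auto simp: le_nat_floor less_Suc_eq_le le_nat_iff le_floor_iff)
  have "ln (x / real n) \<le> ln (real (Suc N) / real n)"
    using assms N by (subst ln_le_cancel_iff) (auto intro!: divide_right_mono)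
  also have "\<dots> = (\<Sum>m=n..<Suc N. ln (real (Suc m)) - ln (real m))"
    using assms N sum_Suc_diff'[of n "Suc N" "\<lambda>m. ln (real m)"] by (simp add: ln_div)
  also have "\<dots> \<le> (\<Sum>m=n..<Suc N. 1 / real m)"
  proof (rule sum_mono)
    fix m assume "m \<in> {n..<Suc N}"
    then have m: "m > 0" using assms by auto
    then have "1 + 1 / real m = real (Suc m) / real m" by (simp add: field_simps)
    then have "ln (real (Suc m)) - ln (real m) = ln (1 + 1 / real m)"
      using m by (simp only: ln_div) simp
    also have "\<dots> \<le> 1 / real m" by (rule ln_add_one_self_le_self) auto
    finally show "ln (real (Suc m)) - ln (real m) \<le> 1 / real m" .
  qed
  finally show ?thesis by (simp add: set_eq)
qed

text \<open>Partial summation without integrals: ln (x/n) is bounded by a harmonic sum over [n, x]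
  and the order of summation is exchanged. It serves both for all positive integers and for the
  primes.\<close>

lemma sum_ln_quotient_le:
  assumes "0 \<notin> S"
  shows "(\<Sum>n | n \<in> S \<and> real n \<le> x. ln (x / real n))
    \<le> (\<Sum>m | 0 < m \<and> real m \<le> x. real (card {n\<in>S. n \<le> m}) / real m)"
proof -
  have fin: "finite {n. P n \<and> real n \<le> x}" for P
    by (rule finite_subset[OF _ finite_nat_le_real[of x]]) auto
  have "(\<Sum>n | n \<in> S \<and> real n \<le> x. ln (x / real n))
      \<le> (\<Sum>n | n \<in> S \<and> real n \<le> x. \<Sum>m | n \<le> m \<and> real m \<le> x. 1 / real m)"
    using assms by (intro sum_mono ln_quotient_le_sum_inverse) (auto intro: Nat.gr0I)
  also have "\<dots> = (\<Sum>n | n \<in> S \<and> real n \<le> x. \<Sum>m | m \<in> {m. 0 < m \<and> real m \<le> x} \<and> n \<le> m. 1 / real m)"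
    using assms by (intro sum.cong refl) (auto intro: Nat.gr0I)
  also have "\<dots> = (\<Sum>m | 0 < m \<and> real m \<le> x. \<Sum>n | n \<in> {n. n \<in> S \<and> real n \<le> x} \<and> n \<le> m. 1 / real m)"
    by (rule sum.swap_restrict) (auto intro: fin)
  also have "\<dots> = (\<Sum>m | 0 < m \<and> real m \<le> x. real (card {n\<in>S. n \<le> m}) / real m)"
  proof (intro sum.cong refl)
    fix m assume "m \<in> {m. 0 < m \<and> real m \<le> x}"
    then have "{n. n \<in> {n. n \<in> S \<and> real n \<le> x} \<and> n \<le> m} = {n\<in>S. n \<le> m}" by auto
    then show "(\<Sum>n | n \<in> {n. n \<in> S \<and> real n \<le> x} \<and> n \<le> m. 1 / real m) = real (card {n\<in>S. n \<le> m}) / real m"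
      by simp
  qed
  finally show ?thesis .
qed

lemma card_pos_nat_le: "x \<ge> 0 \<Longrightarrow> card {n::nat. 0 < n \<and> real n \<le> x} = nat \<lfloor>x\<rfloor>"
proof -
  assume "x \<ge> 0"
  then have "{n::nat. 0 < n \<and> real n \<le> x} = {1..nat \<lfloor>x\<rfloor>}"
    by (auto simp: le_nat_floor le_nat_iff le_floor_iff)
  then show ?thesis by simp
qed

text \<open>Replacing ln^2 n by ln^2 x costs at most 2 ln x times the sum of ln (x/n), hence 2 x ln
  x; the defect between x and the number of terms costs at most ln^2 x \<le> x ln x.\<close>

lemma sum_ln_squared:
  assumes "x \<ge> 3"
  shows "\<bar>(\<Sum>n | real n \<le> x. ln (real n) ^ 2) - x * ln x ^ 2\<bar> \<le> 3 * (x * ln x)"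
proof -
  let ?I = "{n::nat. 0 < n \<and> real n \<le> x}"
  have card: "real (card ?I) \<le> x" "real (card ?I) \<ge> x - 1"
    using card_pos_nat_le[of x] assms by linarith+
  note l1 = ln_ge_1[OF assms]
  have "(\<Sum>n | real n \<le> x. ln (real n) ^ 2) = (\<Sum>n\<in>?I. ln (real n) ^ 2)"
    by (intro sum.mono_neutral_right finite_nat_le_real) (auto intro!: Nat.gr0I)
  then have eq: "x * ln x ^ 2 - (\<Sum>n | real n \<le> x. ln (real n) ^ 2)
     = (x - card ?I) * ln x ^ 2 + (\<Sum>n\<in>?I. ln x ^ 2 - ln (real n) ^ 2)"
    by (simp add: sum_subtractf algebra_simps)
  have 1: "0 \<le> (x - card ?I) * ln x ^ 2" "(x - card ?I) * ln x ^ 2 \<le> 1 * ln x ^ 2"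
    using card by (intro mult_nonneg_nonneg mult_right_mono; simp)+
  have 2: "0 \<le> ln x ^ 2 - ln (real n) ^ 2 \<and> ln x ^ 2 - ln (real n) ^ 2 \<le> 2 * ln x * ln (x / real n)" if "n \<in> ?I" for n
  proof -
    have n: "0 \<le> ln (real n)" "ln (real n) \<le> ln x" using that by auto
    have "(ln x + ln (real n)) * (ln x - ln (real n)) \<le> (2 * ln x) * (ln x - ln (real n))"
      using n by (intro mult_right_mono) auto
    moreover have "0 \<le> (ln x + ln (real n)) * (ln x - ln (real n))" using n by auto
    ultimately show ?thesis using that assms by (simp add: ln_div power2_eq_square algebra_simps)
  qed
  have 3: "0 \<le> (\<Sum>n\<in>?I. ln x ^ 2 - ln (real n) ^ 2)" by (intro sum_nonneg) (use 2 in auto)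
  have "(\<Sum>n\<in>?I. ln x ^ 2 - ln (real n) ^ 2) \<le> (\<Sum>n\<in>?I. 2 * ln x * ln (x / real n))"
    by (intro sum_mono) (use 2 in auto)
  also have "\<dots> = 2 * ln x * (\<Sum>n | n \<in> {0<..} \<and> real n \<le> x. ln (x / real n))"
    by (simp add: sum_distrib_left)
  also have "\<dots> \<le> 2 * ln x * (\<Sum>m\<in>?I. real (card {n\<in>{0<..}. n \<le> m}) / real m)"
    using l1 by (intro mult_left_mono sum_ln_quotient_le) auto
  also have "(\<Sum>m\<in>?I. real (card {n\<in>{0<..}. n \<le> m}) / real m) = (\<Sum>m\<in>?I. 1)"
  proof (intro sum.cong refl)
    fix m :: nat assume m: "m \<in> ?I"
    have "{n\<in>{0<..}. n \<le> m} = {1..m}" by auto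
    then show "real (card {n\<in>{0<..}. n \<le> m}) / real m = 1" using m by simp
  qed
  also have "2 * ln x * (\<Sum>m\<in>?I. 1) \<le> 2 * ln x * x" using card l1 by (intro mult_left_mono) auto
  finally have 4: "(\<Sum>n\<in>?I. ln x ^ 2 - ln (real n) ^ 2) \<le> 2 * (x * ln x)" by (simp only: mult_ac)
  have "ln x ^ 2 \<le> x * ln x" unfolding power2_eq_square
    using ln_le_self[of x] assms l1 by (intro mult_right_mono) auto
  with eq 1 3 4 show ?thesis by linarith
qed

section \<open>The prime counting function\<close>

text \<open>A proper prime power p^k \<le> x has p \<le> sqrt x, and k \<le> 2 ln x because ln 2
  \<ge> 1/2; counting the pairs (p, k) suffices.\<close>

lemma card_proper_primepow_le:
  assumes "x \<ge> 1"
  shows "real (card {n. primepow n \<and> \<not> prime n \<and> real n \<le> x}) \<le> sqrt x * (2 * ln x + 1)"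
proof -
  let ?Q = "{n. primepow n \<and> \<not> prime n \<and> real n \<le> x}"
  define P where "P = {p::nat. 0 < p \<and> real p \<le> sqrt x}"
  define K where "K = {..nat \<lfloor>2 * ln x\<rfloor>}"
  have P: "finite P" "real (card P) \<le> sqrt x"
    using card_pos_nat_le[of "sqrt x"] assms finite_subset[OF _ finite_nat_le_real[of "sqrt x"]]
    by (auto simp: P_def) 
  have K: "real (card K) \<le> 2 * ln x + 1" using assms by (auto simp: K_def)
  have "?Q \<subseteq> (\<lambda>(p, k). p ^ k) ` (P \<times> K)"
  proof
    fix n assume "n \<in> ?Q"
    then have n: "primepow n" "\<not> prime n" "real n \<le> x" by auto
    then obtain p k where pk: "prime p" "k > 0" "n = p ^ k" by (auto simp: primepow_def)
    have k: "k \<noteq> 1" using n pk by auto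
    have p: "p \<ge> 2" using pk prime_ge_2_nat by auto
    have "real p ^ 2 \<le> real p ^ k" using k pk p by (intro power_increasing) auto
    then have "real p ^ 2 \<le> x" using n pk by simp
    then have pP: "p \<in> P" using p real_le_rsqrt by (auto simp: P_def)
    have "(2::real) ^ k \<le> real p ^ k" using p by (intro power_mono) auto
    moreover have "real p ^ k \<le> x" using n(3) pk(3) by simp
    ultimately have "(2::real) ^ k \<le> x" by linarith
    then have "real k * ln 2 \<le> ln x"
      by (metis assms ln_le_cancel_iff ln_realpow order_less_le_trans zero_less_numeral zero_less_one zero_less_power)
    then have "real k * (1/2) \<le> ln x"
      using ln2_ge_two_thirds mult_left_mono[of "1/2" "ln 2" "real k"] by simp
    then have "k \<in> K" by (simp add: K_def le_nat_floor)
    with pP show "n \<in> (\<lambda>(p, k). p ^ k) ` (P \<times> K)" using pk by auto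
  qed
  then have "card ?Q \<le> card ((\<lambda>(p, k). p ^ k) ` (P \<times> K))"
    using P by (intro card_mono) (auto simp: K_def)
  also have "\<dots> \<le> card (P \<times> K)" using P by (intro card_image_le) (auto simp: K_def)
  also have "\<dots> = card P * card K" by (rule card_cartesian_product)
  finally have "real (card ?Q) \<le> real (card P) * real (card K)" by (simp flip: of_nat_mult)
  also have "\<dots> \<le> sqrt x * (2 * ln x + 1)" using P K assms by (intro mult_mono) auto
  finally show ?thesis .
qed

lemma sum_ln_cubed_primes:
  obtains C where "C > 0"
    "\<And>x. x \<ge> 3 \<Longrightarrow> \<bar>(\<Sum>p | prime p \<and> real p \<le> x. ln (real p) ^ 3) - x * ln x ^ 2\<bar> \<le> C * (x * ln x)"
proof -
  obtain C where C: "C > 0" "\<And>x. x \<ge> 3 \<Longrightarrow> \<bar>\<Sum>n | real n \<le> x. psi_coeff n\<bar> \<le> C * (x * ln x)"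
    using psi_coeff_sum_bound by blast
  show ?thesis
  proof (rule that[of "C + 3 + 648"])
    fix x :: real assume x: "x \<ge> 3"
    note l1 = ln_ge_1[OF x]
    let ?Q = "{n. primepow n \<and> \<not> prime n \<and> real n \<le> x}" and ?P = "{p::nat. prime p \<and> real p \<le> x}"
    let ?f = "\<lambda>n. mangoldt n * ln (real n) ^ 2 :: real"
    have fin: "finite {n. P n \<and> real n \<le> x}" for P
      by (rule finite_subset[OF _ finite_nat_le_real[of x]]) auto
    have "(\<Sum>n | real n \<le> x. ?f n) = (\<Sum>n\<in>?P \<union> ?Q. ?f n)"
      by (intro sum.mono_neutral_right finite_nat_le_real) (auto simp: mangoldt_def)
    also have "\<dots> = (\<Sum>n\<in>?P. ?f n) + (\<Sum>n\<in>?Q. ?f n)"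
      using fin[of prime] fin[of "\<lambda>n. primepow n \<and> \<not> prime n"] by (intro sum.union_disjoint) auto
    also have "(\<Sum>n\<in>?P. ?f n) = (\<Sum>p\<in>?P. ln (real p) ^ 3)"
      by (intro sum.cong) (auto simp: eval_nat_numeral)
    finally have split: "(\<Sum>n | real n \<le> x. psi_coeff n)
       = (\<Sum>p\<in>?P. ln (real p) ^ 3) + (\<Sum>n\<in>?Q. ?f n) - (\<Sum>n | real n \<le> x. ln (real n) ^ 2)"
      unfolding psi_coeff_eq sum_subtractf by simp
    have Q0: "(\<Sum>n\<in>?Q. ?f n) \<ge> 0" by (intro sum_nonneg mult_nonneg_nonneg mangoldt_nonneg) auto
    have "(\<Sum>n\<in>?Q. ?f n) \<le> (\<Sum>n\<in>?Q. ln x ^ 3)"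
    proof (rule sum_mono)
      fix n assume n: "n \<in> ?Q"
      then have n0: "n > 0" using primepow_gt_0_nat by auto
      have "mangoldt n \<le> ln (real n)" using mangoldt_le[of n] n0 by simp
      also have le: "ln (real n) \<le> ln x" using n n0 by auto
      finally have "?f n \<le> ln x * ln x ^ 2"
        using n0 le l1 by (intro mult_mono power_mono) auto
      then show "?f n \<le> ln x ^ 3" by (simp add: eval_nat_numeral)
    qed
    also have "\<dots> = real (card ?Q) * ln x ^ 3" by simp
    also have "\<dots> \<le> (sqrt x * (2 * ln x + 1)) * ln x ^ 3"
      using card_proper_primepow_le[of x] x l1 by (intro mult_right_mono) auto
    \<comment> \<open>The exponent 1/6 makes the cube of 6 x^(1/6) equal to 216 sqrt x, so the
      proper prime powers fit into O(x ln x).\<close>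
    also have "\<dots> \<le> (sqrt x * (3 * ln x)) * (216 * sqrt x)"
    proof (intro mult_mono)
      have "ln x \<le> x powr (1/6) / (1/6)" using x by (intro ln_powr_bound) auto
      then have "ln x ^ 3 \<le> (6 * x powr (1/6)) ^ 3" using l1 by (intro power_mono) auto
      also have "\<dots> = 216 * sqrt x" using x by (simp add: power_mult_distrib powr_power powr_half_sqrt)
      finally show "ln x ^ 3 \<le> 216 * sqrt x" .
    qed (use x l1 in auto)
    also have "\<dots> = 648 * (x * ln x)" using x by simp
    finally have Q1: "(\<Sum>n\<in>?Q. ?f n) \<le> 648 * (x * ln x)" .
    show "\<bar>(\<Sum>p\<in>?P. ln (real p) ^ 3) - x * ln x ^ 2\<bar> \<le> (C + 3 + 648) * (x * ln x)"
      using C(2)[OF x] sum_ln_squared[OF x] split Q0 Q1 unfolding distrib_right by linarith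
  qed (use C in auto)
qed

text \<open>Splitting at sqrt x: smaller terms are at most 2 and there are few of them, larger ones
  are at most 2 / ln x.\<close>

lemma sum_inverse_ln_le:
  assumes "x \<ge> 3"
  shows "(\<Sum>m | 2 \<le> m \<and> real m \<le> x. 1 / ln (real m)) \<le> 6 * (x / ln x)"
proof -
  note l1 = ln_ge_1[OF assms]
  let ?A = "{m::nat. 2 \<le> m \<and> real m \<le> x}"
  let ?B = "{m::nat. 2 \<le> m \<and> real m \<le> sqrt x}" and ?I = "{m::nat. 0 < m \<and> real m \<le> x}"
  note sq = sqrt_le_quotient_ln[OF assms]
  have fin: "finite {n::nat. P n \<and> real n \<le> y}" for P y
    by (rule finite_subset[OF _ finite_nat_le_real[of y]]) auto
  have cB: "real (card {m::nat. 0 < m \<and> real m \<le> sqrt x}) \<le> sqrt x" "real (card ?I) \<le> x"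
    using card_pos_nat_le[of "sqrt x"] card_pos_nat_le[of x] assms by auto
  have "(\<Sum>m\<in>?A. 1 / ln (real m)) \<le> (\<Sum>m\<in>?A. (if real m \<le> sqrt x then 2 else 0) + 2 / ln x)"
  proof (rule sum_mono)
    fix m assume m: "m \<in> ?A"
    show "1 / ln (real m) \<le> (if real m \<le> sqrt x then 2 else 0) + 2 / ln x"
    proof (cases "real m \<le> sqrt x")
      case True
      have "ln 2 \<le> ln (real m)" using m by auto
      then have "1 / ln (real m) \<le> 1 / (1/2)" using ln2_ge_two_thirds by (intro divide_left_mono) auto
      then have "1 / ln (real m) \<le> 2" by simp
      moreover have "2 / ln x \<ge> 0" using l1 by auto
      ultimately show ?thesis unfolding if_P[OF True] by linarith
    next
      case False
      have "ln (sqrt x) \<le> ln (real m)" using False assms m by (subst ln_le_cancel_iff) auto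
      then have "ln x / 2 \<le> ln (real m)" using assms by (simp add: ln_sqrt)
      then have "1 / ln (real m) \<le> 1 / (ln x / 2)" using l1 by (intro divide_left_mono) auto
      then show ?thesis using False by simp
    qed
  qed
  also have "\<dots> = (\<Sum>m\<in>?A. if real m \<le> sqrt x then 2 else 0) + real (card ?A) * (2 / ln x)"
    by (simp add: sum.distrib)
  also have "(\<Sum>m\<in>?A. if real m \<le> sqrt x then 2 else (0::real)) = (\<Sum>m\<in>{m\<in>?A. real m \<le> sqrt x}. 2)"
    by (rule sum.inter_filter[symmetric]) (rule fin)
  also have "\<dots> = 2 * real (card {m\<in>?A. real m \<le> sqrt x})" by simp
  also have "card {m\<in>?A. real m \<le> sqrt x} \<le> card {m::nat. 0 < m \<and> real m \<le> sqrt x}"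
    by (intro card_mono fin) auto
  also have "card ?A \<le> card ?I" by (intro card_mono fin) auto
  finally have "(\<Sum>m\<in>?A. 1 / ln (real m)) \<le> 2 * real (card {m::nat. 0 < m \<and> real m \<le> sqrt x}) + real (card ?I) * (2 / ln x)"
    using l1 by (simp add: divide_right_mono mult_right_mono)
  also have "\<dots> \<le> 2 * sqrt x + x * (2 / ln x)"
    using cB l1 by (intro add_mono mult_right_mono) auto
  finally show ?thesis using sq by simp
qed

definition prime_count :: "real \<Rightarrow> real" where
  "prime_count x = real (card {p. prime p \<and> real p \<le> x})"

lemma finite_primes_le: "finite {p::nat. prime p \<and> real p \<le> x}"
  by (rule finite_subset[OF _ finite_nat_le_real[of x]]) auto

lemma prime_count_le_self:
  assumes "x \<ge> 0"
  shows "prime_count x \<le> x"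
proof -
  have "card {p. prime p \<and> real p \<le> x} \<le> card {n::nat. 0 < n \<and> real n \<le> x}"
    by (intro card_mono finite_subset[OF _ finite_nat_le_real[of x]]) (auto simp: prime_gt_0_nat)
  also have "\<dots> = nat \<lfloor>x\<rfloor>" by (rule card_pos_nat_le) fact
  finally show ?thesis using assms unfolding prime_count_def by linarith
qed

text \<open>A Chebyshev bound: each prime in (sqrt x, x] has weight at least (ln x / 2)^3 in the
  cubed logarithm sum, and the primes up to sqrt x are counted trivially. In the constant, 8 (1 + C)
  comes from the former and 2 from the latter.\<close>

lemma prime_count_upper:
  obtains C where "C \<ge> 1" "\<And>x. x \<ge> 2 \<Longrightarrow> prime_count x \<le> C * (x / ln x)"
proof -
  obtain C where C: "C > 0"
    "\<And>x. x \<ge> 3 \<Longrightarrow> \<bar>(\<Sum>p | prime p \<and> real p \<le> x. ln (real p) ^ 3) - x * ln x ^ 2\<bar> \<le> C * (x * ln x)"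
    using sum_ln_cubed_primes by blast
  show ?thesis
  proof (rule that[of "10 + 8 * C"])
    fix x :: real assume x2: "x \<ge> 2"
    show "prime_count x \<le> (10 + 8 * C) * (x / ln x)"
    proof (cases "x \<ge> 3")
      case False
      have "prime_count x \<le> x" using x2 by (intro prime_count_le_self) auto
      also have "x \<le> 10 * (x / ln x)" using x2 False ln_le_self[of x] by (auto simp: field_simps)
      also have "\<dots> \<le> (10 + 8 * C) * (x / ln x)" using C x2 by (intro mult_right_mono) auto
      finally show ?thesis .
    next
      case True
      note x = True and l1 = ln_ge_1[OF True]
      let ?P = "{p::nat. prime p \<and> real p \<le> x}"
      let ?P1 = "{p::nat. prime p \<and> real p \<le> sqrt x}"
      let ?P2 = "{p::nat. prime p \<and> sqrt x < real p \<and> real p \<le> x}"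
      have f2: "finite ?P2" by (rule finite_subset[OF _ finite_primes_le[of x]]) auto
      have "card ?P \<le> card (?P1 \<union> ?P2)"
        using f2 by (intro card_mono) (auto simp: finite_primes_le)
      also have "\<dots> \<le> card ?P1 + card ?P2" by (rule card_Un_le)
      finally have "prime_count x \<le> prime_count (sqrt x) + real (card ?P2)"
        by (simp add: prime_count_def flip: of_nat_add)
      also have "prime_count (sqrt x) \<le> sqrt x" using x by (intro prime_count_le_self) auto
      finally have 1: "prime_count x \<le> sqrt x + real (card ?P2)" by simp
      have "real (card ?P2) * (ln x / 2) ^ 3 = (\<Sum>p\<in>?P2. (ln x / 2) ^ 3)" by simp
      also have "\<dots> \<le> (\<Sum>p\<in>?P2. ln (real p) ^ 3)"
      proof (intro sum_mono power_mono)
        fix p assume p: "p \<in> ?P2"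
        then have "ln (sqrt x) \<le> ln (real p)" using x by (subst ln_le_cancel_iff) (auto simp: prime_gt_0_nat)
        then show "ln x / 2 \<le> ln (real p)" using x by (simp add: ln_sqrt)
      qed (use l1 in auto)
      also have "\<dots> \<le> (\<Sum>p\<in>?P. ln (real p) ^ 3)"
        by (intro sum_mono2 finite_primes_le) (auto intro!: zero_le_power simp: prime_gt_0_nat Suc_le_eq)
      also have "\<dots> \<le> x * ln x ^ 2 + C * (x * ln x)" using C(2)[OF x] by linarith
      also have "\<dots> \<le> x * ln x ^ 2 + C * (x * ln x ^ 2)"
        using C x l1 by (intro add_left_mono mult_left_mono) (auto simp: power2_eq_square)
      finally have "real (card ?P2) * (ln x / 2) ^ 3 \<le> (1 + C) * (x * ln x ^ 2)" by (simp add: algebra_simps)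
      then have "(real (card ?P2) * ln x) * ln x ^ 2 \<le> (8 * (1 + C) * x) * ln x ^ 2"
        by (simp add: field_simps eval_nat_numeral)
      then have "real (card ?P2) * ln x \<le> 8 * (1 + C) * x"
        using l1 by (elim mult_right_le_imp_le) auto
      then have "real (card ?P2) \<le> 8 * (1 + C) * (x / ln x)"
        using l1 by (simp add: pos_le_divide_eq)
      with 1 sqrt_le_quotient_ln[OF x] show ?thesis unfolding distrib_right distrib_left by linarith
    qed
  qed (use C in auto)
qed

text \<open>Replacing ln^3 p by ln^3 x costs at most 3 ln^2 x times the sum of ln (x/p) over primes,
  which is O(x / ln x) by partial summation and the Chebyshev bound. Dividing the resulting error
  O(x ln x) by ln^3 x gives the claim.\<close>

theorem prime_count_asymptotics:
  obtains C where "C > 0" "\<And>x. x \<ge> 3 \<Longrightarrow> \<bar>prime_count x - x / ln x\<bar> \<le> C * (x / ln x ^ 2)"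
proof -
  obtain C where C: "C > 0"
    "\<And>x. x \<ge> 3 \<Longrightarrow> \<bar>(\<Sum>p | prime p \<and> real p \<le> x. ln (real p) ^ 3) - x * ln x ^ 2\<bar> \<le> C * (x * ln x)"
    using sum_ln_cubed_primes by blast
  obtain D where D: "D \<ge> 1" "\<And>x. x \<ge> 2 \<Longrightarrow> prime_count x \<le> D * (x / ln x)"
    using prime_count_upper by blast
  show ?thesis
  proof (rule that[of "C + 18 * D"])
    fix x :: real assume x: "x \<ge> 3"
    note l1 = ln_ge_1[OF x]
    let ?P = "{p::nat. prime p \<and> real p \<le> x}"
    define B where "B = (\<Sum>p\<in>?P. ln (real p) ^ 3)"
    have "(\<Sum>p\<in>?P. ln (x / real p)) \<le> (\<Sum>m | 0 < m \<and> real m \<le> x. real (card {p\<in>{p. prime p}. p \<le> m}) / real m)"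
      using sum_ln_quotient_le[of "{p. prime p}" x] by simp
    also have "\<dots> = (\<Sum>m | 2 \<le> m \<and> real m \<le> x. prime_count (real m) / real m)"
    proof (rule sum.mono_neutral_cong_right)
      show "\<forall>m\<in>{m. 0 < m \<and> real m \<le> x} - {m. 2 \<le> m \<and> real m \<le> x}. real (card {p\<in>{p. prime p}. p \<le> m}) / real m = 0"
      proof
        fix m assume "m \<in> {m. 0 < m \<and> real m \<le> x} - {m. 2 \<le> m \<and> real m \<le> x}"
        then have "m < 2" by auto
        then have "{p\<in>{p. prime p}. p \<le> m} = {}" by (auto dest: prime_ge_2_nat)
        then show "real (card {p\<in>{p. prime p}. p \<le> m}) / real m = 0" by simp
      qed
    qed (auto simp: prime_count_def intro: finite_subset[OF _ finite_nat_le_real[of x]])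
    also have "\<dots> \<le> (\<Sum>m | 2 \<le> m \<and> real m \<le> x. D * (1 / ln (real m)))"
    proof (rule sum_mono)
      fix m assume "m \<in> {m. 2 \<le> m \<and> real m \<le> x}"
      then have m: "m \<ge> 2" by auto
      have "prime_count (real m) / real m \<le> (D * (real m / ln (real m))) / real m"
        using m by (intro divide_right_mono D) auto
      then show "prime_count (real m) / real m \<le> D * (1 / ln (real m))" using m by simp
    qed
    also have "\<dots> \<le> D * (6 * (x / ln x))"
      unfolding sum_distrib_left[symmetric] using D sum_inverse_ln_le[OF x] by (intro mult_left_mono) auto
    finally have S: "(\<Sum>p\<in>?P. ln (x / real p)) \<le> 6 * D * (x / ln x)" by (simp add: mult_ac)
    have diff: "0 \<le> ln x ^ 3 - ln (real p) ^ 3 \<and> ln x ^ 3 - ln (real p) ^ 3 \<le> 3 * ln x ^ 2 * ln (x / real p)"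
      if p: "p \<in> ?P" for p
    proof -
      have p2: "p \<ge> 2" using p prime_ge_2_nat by auto
      define l where "l = ln (real p)"
      have l: "0 \<le> l" "l \<le> ln x" using p p2 by (auto simp: l_def)
      have "l ^ 3 \<le> ln x ^ 3" using l by (intro power_mono)
      moreover have "ln x ^ 3 - l ^ 3 = (ln x - l) * (ln x ^ 2 + ln x * l + l ^ 2)"
        by (simp add: algebra_simps eval_nat_numeral)
      moreover have "(ln x - l) * (ln x ^ 2 + ln x * l + l ^ 2) \<le> (ln x - l) * (ln x ^ 2 + ln x * ln x + ln x ^ 2)"
        using l by (intro mult_left_mono add_mono power_mono) auto
      ultimately show ?thesis using p2 x by (simp add: l_def ln_div power2_eq_square algebra_simps)
    qed
    have "prime_count x * ln x ^ 3 - B = (\<Sum>p\<in>?P. ln x ^ 3 - ln (real p) ^ 3)"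
      by (simp add: B_def prime_count_def sum_subtractf)
    moreover have "(\<Sum>p\<in>?P. ln x ^ 3 - ln (real p) ^ 3) \<ge> 0" by (intro sum_nonneg) (use diff in auto)
    moreover have "(\<Sum>p\<in>?P. ln x ^ 3 - ln (real p) ^ 3) \<le> (\<Sum>p\<in>?P. 3 * ln x ^ 2 * ln (x / real p))"
      by (intro sum_mono) (use diff in auto)
    moreover have "(\<Sum>p\<in>?P. 3 * ln x ^ 2 * ln (x / real p)) \<le> 3 * ln x ^ 2 * (6 * D * (x / ln x))"
      unfolding sum_distrib_left[symmetric] using S by (intro mult_left_mono) auto
    moreover have "3 * ln x ^ 2 * (6 * D * (x / ln x)) = 18 * D * (x * ln x)"
      using l1 by (simp add: power2_eq_square)
    ultimately have "\<bar>prime_count x * ln x ^ 3 - B\<bar> \<le> 18 * D * (x * ln x)" by linarith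
    moreover have "\<bar>B - x * ln x ^ 2\<bar> \<le> C * (x * ln x)" unfolding B_def by (rule C(2)[OF x])
    ultimately have "\<bar>prime_count x * ln x ^ 3 - x * ln x ^ 2\<bar> \<le> (C + 18 * D) * (x * ln x)"
      unfolding distrib_right by linarith
    also have "prime_count x * ln x ^ 3 - x * ln x ^ 2 = (prime_count x - x / ln x) * ln x ^ 3"
      using l1 by (simp add: field_simps eval_nat_numeral)
    also have "\<bar>\<dots>\<bar> = \<bar>prime_count x - x / ln x\<bar> * ln x ^ 3" using l1 by (simp add: abs_mult)
    finally have "(\<bar>prime_count x - x / ln x\<bar> * ln x ^ 2) * ln x \<le> ((C + 18 * D) * x) * ln x"
      by (simp only: eval_nat_numeral power_Suc mult_ac)
    then have "\<bar>prime_count x - x / ln x\<bar> * ln x ^ 2 \<le> (C + 18 * D) * x"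
      using l1 by (elim mult_right_le_imp_le) auto
    then show "\<bar>prime_count x - x / ln x\<bar> \<le> (C + 18 * D) * (x / ln x ^ 2)"
      using l1 by (simp add: pos_le_divide_eq)
  qed (use C D in auto)
qed

text \<open>The strict inequality matches the PSP numbers strictly smaller than n; the change from
  \<open>prime_count\<close> is at most 1.\<close>

definition prime_count_below :: "real \<Rightarrow> real" where
  "prime_count_below x = real (card {p. prime p \<and> real p < x})"

lemma prime_count_below_le: "prime_count_below x \<le> prime_count x"
  unfolding prime_count_below_def prime_count_def
  by (intro of_nat_mono card_mono finite_primes_le) auto

lemma prime_count_le_below: "prime_count x \<le> prime_count_below x + 1"
proof -
  have "{p. prime p \<and> real p \<le> x} \<subseteq> insert (nat \<lfloor>x\<rfloor>) {p. prime p \<and> real p < x}"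
  proof
    fix p assume "p \<in> {p. prime p \<and> real p \<le> x}"
    then show "p \<in> insert (nat \<lfloor>x\<rfloor>) {p. prime p \<and> real p < x}"
      by (cases "real p < x") auto
  qed
  then have "card {p. prime p \<and> real p \<le> x} \<le> card (insert (nat \<lfloor>x\<rfloor>) {p. prime p \<and> real p < x})"
    by (intro card_mono) (auto intro: finite_subset[OF _ finite_primes_le[of x]])
  also have "\<dots> \<le> Suc (card {p. prime p \<and> real p < x})" by (rule card_insert_le_m1) auto
  finally show ?thesis unfolding prime_count_below_def prime_count_def by linarith
qed

lemma prime_count_below_asymptotics:
  obtains C where "C > 0" "\<And>x. x \<ge> 3 \<Longrightarrow> \<bar>prime_count_below x - x / ln x\<bar> \<le> C * (x / ln x ^ 2)"
proof -
  obtain C where C: "C > 0" "\<And>x. x \<ge> 3 \<Longrightarrow> \<bar>prime_count x - x / ln x\<bar> \<le> C * (x / ln x ^ 2)"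
    using prime_count_asymptotics by blast
  show ?thesis
  proof (rule that[of "C + 4"])
    fix x :: real assume x: "x \<ge> 3"
    have "1 \<le> 4 * (x / ln x ^ 2)" using ln_squared_le[of x] ln_ge_1[OF x] x by (simp add: field_simps)
    then show "\<bar>prime_count_below x - x / ln x\<bar> \<le> (C + 4) * (x / ln x ^ 2)"
      using C(2)[OF x] prime_count_below_le[of x] prime_count_le_below[of x]
      unfolding distrib_right by linarith
  qed (use C in auto)
qed

section \<open>Counting PSP numbers\<close>

text \<open>For distinct q and q' the squares are coprime, so q^2 would divide the prime p'. This
  covers p = q as well, so cubes of primes are not counted twice.\<close>

lemma prime_times_prime_squared_inj:
  fixes p q p' q' :: nat
  assumes "prime p" "prime q" "prime p'" "prime q'" "p * q ^ 2 = p' * q' ^ 2"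
  shows "p = p' \<and> q = q'"
proof -
  have "q = q'"
  proof (rule ccontr)
    assume ne: "q \<noteq> q'"
    have cop: "coprime q q'" using ne assms primes_coprime by blast
    then have "coprime (q ^ 2) (q' ^ 2)" by simp
    moreover have "q ^ 2 dvd p' * q' ^ 2" using assms(5) by (metis dvd_triv_right)
    ultimately have "q ^ 2 dvd p'" using coprime_dvd_mult_left_iff by blast
    then have "q * q dvd p'" by (simp add: power2_eq_square)
    moreover from this have "q dvd p'" by (rule dvd_mult_left)
    then have "q = p'" using assms by (intro primes_dvd_imp_eq)
    ultimately have "q * q \<le> 1 * q" using prime_gt_0_nat[OF assms(2)] by (intro dvd_imp_le) auto
    then show False using prime_ge_2_nat[OF assms(2)] by simp
  qed
  then show ?thesis using assms prime_gt_0_nat[of q] by simp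
qed

lemma PSP_eq_sum:
  "real (PSP n) = (\<Sum>q | prime q \<and> q \<le> n. prime_count_below (real n / real q ^ 2))"
proof -
  let ?A = "{q. prime q \<and> q \<le> n}" and ?B = "\<lambda>q. {p. prime p \<and> real p < real n / real q ^ 2}"
  have finB: "finite (?B q)" for q
    by (rule finite_subset[OF _ finite_primes_le[of "real n / real q ^ 2"]]) auto
  have mem: "real p < real n / real q ^ 2 \<longleftrightarrow> p * q ^ 2 < n" if "q > 0" for p q
  proof -
    have "real p < real n / real q ^ 2 \<longleftrightarrow> real (p * q ^ 2) < real n" using that by (simp add: field_simps)
    then show ?thesis by (simp only: of_nat_less_iff)
  qed
  have "{m. m < n \<and> PSP_number m} = (\<lambda>(q, p). p * q ^ 2) ` Sigma ?A ?B"
  proof safe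
    fix m assume m: "m < n" "PSP_number m"
    then obtain p q where pq: "prime p" "prime q" "m = p * q ^ 2" by (auto simp: PSP_number_def)
    have "q \<le> p * q ^ 2" using pq prime_gt_0_nat[of p] prime_gt_0_nat[of q] by (simp add: power2_eq_square)
    then show "m \<in> (\<lambda>(q, p). p * q ^ 2) ` Sigma ?A ?B"
      using pq m mem[of q p] prime_gt_0_nat[of q] by (auto intro!: image_eqI[of _ _ "(q, p)"])
  qed (auto simp: PSP_number_def mem prime_gt_0_nat)
  moreover have "inj_on (\<lambda>(q, p). p * q ^ 2) (Sigma ?A ?B)"
  proof (rule inj_onI)
    fix x y assume "x \<in> Sigma ?A ?B" "y \<in> Sigma ?A ?B"
      "(case x of (q, p) \<Rightarrow> p * q ^ 2) = (case y of (q, p) \<Rightarrow> p * q ^ 2)"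
    then show "x = y"
      using prime_times_prime_squared_inj[of "snd x" "fst x" "snd y" "fst y"]
      by (auto simp: case_prod_unfold prod_eq_iff)
  qed
  ultimately have "PSP n = card (Sigma ?A ?B)" by (simp add: PSP_def card_image)
  also have "\<dots> = (\<Sum>q\<in>?A. card (?B q))" by (intro card_SigmaI) (auto simp: finB)
  finally show ?thesis by (simp add: prime_count_below_def)
qed

text \<open>A bound uniform in \<open>q\<close>: for \<open>q\<^sup>4 \<le> n\<close> replacing \<open>log (n/q\<^sup>2)\<close> by \<open>log n\<close> costs a factor
  \<open>log q\<close>, and for \<open>q\<^sup>4 > n\<close> the trivial bound suffices because \<open>\<surd>q\<close> dominates \<open>log\<^sup>2 n\<close>.\<close>

lemma prime_count_below_quotient:
  obtains D where "D > 0"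
    "\<And>n q. n \<ge> 9 \<Longrightarrow> q > 0 \<Longrightarrow> \<bar>prime_count_below (real n / real q ^ 2) - real n / real q ^ 2 / ln (real n)\<bar>
       \<le> D * (real n / ln (real n) ^ 2) * real q powr (-(3/2))"
proof -
  obtain C where C: "C > 0" "\<And>x. x \<ge> 3 \<Longrightarrow> \<bar>prime_count_below x - x / ln x\<bar> \<le> C * (x / ln x ^ 2)"
    using prime_count_below_asymptotics by blast
  show ?thesis
  \<comment> \<open>264 is 8 + 256: the 8 is from exchanging ln y for ln N when Q^4 \<le> N, the 256
    from the trivial bound otherwise.\<close>
  proof (rule that[of "4 * C + 264"])
    fix n q :: nat assume n: "n \<ge> 9" and q: "q > 0"
    define N where "N = real n"
    define Q where "Q = real q"
    define L where "L = ln N"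
    define y where "y = N / Q ^ 2"
    have N: "N \<ge> 9" using n by (simp add: N_def)
    have Q: "Q \<ge> 1" using q by (simp add: Q_def)
    have L: "L \<ge> 1" unfolding L_def using N by (intro ln_ge_1) auto
    have y: "y > 0" using N Q by (simp add: y_def)
    have sq: "sqrt Q \<ge> 1" using Q by simp
    have goal: "\<bar>prime_count_below y - y / L\<bar> \<le> (4 * C + 264) * sqrt Q * (y / L ^ 2)"
    proof (cases "Q ^ 4 \<le> N")
      case True
      \<comment> \<open>In this range y \<ge> sqrt N, so ln y is at least half of ln N; N \<ge> 9
        then also gives the y \<ge> 3 required by the prime count.\<close>
      have "(Q ^ 2) ^ 2 \<le> N" using True by (simp flip: power_mult)
      then have "Q ^ 2 \<le> sqrt N" by (rule real_le_rsqrt)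
      moreover have "sqrt N * sqrt N = N" using N by simp
      ultimately have "sqrt N * Q ^ 2 \<le> N" using N by (metis mult_left_mono real_sqrt_ge_zero order_trans zero_le_numeral)
      then have yN: "y \<ge> sqrt N" using Q by (simp add: y_def field_simps)
      have "sqrt N \<ge> sqrt 9" using N by (intro real_sqrt_le_mono)
      moreover have "sqrt 9 = (3::real)" using real_sqrt_unique[of 3 9] by simp
      ultimately have y3: "y \<ge> 3" using yN by simp
      define l where "l = ln y"
      have l: "l \<ge> L / 2"
      proof -
        have "ln (sqrt N) \<le> ln y" using yN N y by (subst ln_le_cancel_iff) auto
        then show ?thesis using N by (simp add: l_def L_def ln_sqrt)
      qed
      have lL: "l = L - 2 * ln Q" using N Q by (simp add: l_def L_def y_def ln_div ln_realpow)
      have lnQ: "0 \<le> ln Q" "ln Q \<le> 2 * sqrt Q" using Q ln_le_two_sqrt by auto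
      have "\<bar>prime_count_below y - y / l\<bar> \<le> C * (y / l ^ 2)" unfolding l_def by (rule C(2)[OF y3])
      also have "\<dots> \<le> C * (y / (L / 2) ^ 2)"
        using C y L l by (intro mult_left_mono divide_left_mono power_mono) auto
      also have "\<dots> = 4 * C * (y / L ^ 2)" by (simp add: power_divide)
      finally have 1: "\<bar>prime_count_below y - y / l\<bar> \<le> 4 * C * (y / L ^ 2)" .
      have "2 * ln Q = L - l" using lL by simp
      then have "y / l - y / L = y * (2 * ln Q) / (l * L)"
        using l L by (simp only:) (simp add: field_simps)
      also have "\<dots> \<le> y * (2 * (2 * sqrt Q)) / (L / 2 * L)"
        using l L lnQ y sq by (intro frac_le mult_left_mono mult_right_mono) auto
      also have "\<dots> = 8 * sqrt Q * (y / L ^ 2)" by (simp add: power2_eq_square)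
      finally have 2: "y / l - y / L \<le> 8 * sqrt Q * (y / L ^ 2)" .
      have 3: "y / l - y / L \<ge> 0" using lL lnQ l L y by (auto intro!: divide_left_mono)
      have "\<bar>prime_count_below y - y / L\<bar> \<le> 4 * C * (y / L ^ 2) + 8 * sqrt Q * (y / L ^ 2)"
        using 1 2 3 by linarith
      also have "\<dots> \<le> 4 * C * sqrt Q * (y / L ^ 2) + 264 * sqrt Q * (y / L ^ 2)"
        using C y sq by (intro add_mono mult_right_mono) auto
      finally show ?thesis by (simp add: algebra_simps)
    next
      case False
      \<comment> \<open>The exponent 1/16 is such that L^2 \<le> 256 N^(1/8), and N < Q^4 turns
        N^(1/8) into at most sqrt Q.\<close>
      have "L \<le> N powr (1/16) / (1/16)" unfolding L_def using N by (intro ln_powr_bound) auto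
      then have "L ^ 2 \<le> (16 * N powr (1/16)) ^ 2" using L by (intro power_mono) auto
      also have "\<dots> = 256 * N powr (1/8)" using N by (simp add: power_mult_distrib powr_power)
      also have "N powr (1/8) \<le> (Q ^ 4) powr (1/8)" using False N by (intro powr_mono2) auto
      also have "(Q ^ 4) powr (1/8) = sqrt Q"
      proof -
        have "Q ^ 4 = Q powr 4" using Q by simp
        then show ?thesis by (simp only: powr_powr) (use Q in \<open>simp add: powr_half_sqrt\<close>)
      qed
      finally have L2: "L ^ 2 \<le> 256 * sqrt Q" by simp
      have "prime_count_below y \<le> y" using prime_count_below_le[of y] prime_count_le_self[of y] y by linarith
      moreover have "prime_count_below y \<ge> 0" by (simp add: prime_count_below_def)
      moreover have "0 \<le> y / L" "y / L \<le> y" using y L by (auto simp: field_simps)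
      ultimately have "\<bar>prime_count_below y - y / L\<bar> \<le> y" by linarith
      also have "y \<le> 256 * sqrt Q * (y / L ^ 2)"
        using mult_left_mono[OF L2, of y] y L by (simp add: field_simps)
      also have "\<dots> \<le> (4 * C + 264) * sqrt Q * (y / L ^ 2)"
        using C y sq by (intro mult_right_mono) auto
      finally show ?thesis .
    qed
    \<comment> \<open>The loss sqrt Q is harmless against 1/Q^2: the exponent -3/2 is still summable
      over q.\<close>
    have "Q powr (-(3/2)) = sqrt Q / Q ^ 2"
      using Q powr_diff[of Q "1/2" 2] by (simp add: powr_half_sqrt)
    then have "sqrt Q * (y / L ^ 2) = N / L ^ 2 * Q powr (-(3/2))"
      by (simp only: y_def) (simp add: mult_ac)
    with goal have "\<bar>prime_count_below y - y / L\<bar> \<le> (4 * C + 264) * (N / L ^ 2 * Q powr (-(3/2)))"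
      by (simp only: mult.assoc)
    then show "\<bar>prime_count_below (real n / real q ^ 2) - real n / real q ^ 2 / ln (real n)\<bar>
       \<le> (4 * C + 264) * (real n / ln (real n) ^ 2) * real q powr (-(3/2))"
      by (simp add: y_def L_def N_def Q_def mult.assoc)
  qed (use C in auto)
qed

theorem theorem5p1:
  "(\<lambda>n::nat. real (PSP n) - prime_zeta 2 * (real n / ln (real n)))
     \<in> O(\<lambda>n. real n / (ln (real n)) ^ 2)"
proof -
  obtain D where D: "D > 0"
    "\<And>n q. n \<ge> 9 \<Longrightarrow> q > 0 \<Longrightarrow> \<bar>prime_count_below (real n / real q ^ 2) - real n / real q ^ 2 / ln (real n)\<bar>
       \<le> D * (real n / ln (real n) ^ 2) * real q powr (-(3/2))"
    using prime_count_below_quotient by blast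
  let ?P = "{q::nat. prime q}"
  have "(\<lambda>q. norm (real q powr (-(3/2)))) summable_on UNIV"
    by (rule norm_summable_imp_summable_on) (simp add: summable_real_powr_iff)
  then have sum32: "(\<lambda>q. real q powr (-(3/2))) summable_on ?P"
    by (rule summable_on_subset_banach[OF abs_summable_summable]) simp
  define T where "T = (\<Sum>\<^sub>\<infinity>q\<in>?P. real q powr (-(3/2)))"
  have zeta2: "((\<lambda>q. 1 / real q ^ 2) has_sum prime_zeta 2) ?P"
  proof -
    have "(\<lambda>q. 1 / real q ^ 2) summable_on ?P"
      using prime_zeta_2_summable by (rule summable_on_cong[THEN iffD1, rotated])
        (auto simp: powr_minus_divide prime_gt_0_nat)
    then show ?thesis unfolding prime_zeta_2 by (rule has_sum_infsum)
  qed
  show ?thesis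
  proof (rule bigoI[of _ "D * T"])
    show "\<forall>\<^sub>F n in sequentially. norm (real (PSP n) - prime_zeta 2 * (real n / ln (real n))) \<le> D * T * norm (real n / ln (real n) ^ 2)"
      using eventually_ge_at_top[of 9]
    proof eventually_elim
      case (elim n)
      let ?f = "\<lambda>q. prime_count_below (real n / real q ^ 2)"
      have "(?f has_sum real (PSP n)) {q. prime q \<and> q \<le> n}"
        unfolding PSP_eq_sum by (intro has_sum_finite) auto
      \<comment> \<open>For q > n the quotient n/q^2 is at most 1 and no prime lies below it.
        Summing over all primes gives the count the same index set as the series for
        \<open>prime_zeta 2\<close>, so the two are subtracted term by term with no tail to
        estimate.\<close>
      also have "?this \<longleftrightarrow> (?f has_sum real (PSP n)) ?P"
      proof (rule has_sum_cong_neutral)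
        fix q assume "q \<in> ?P - {q. prime q \<and> q \<le> n}"
        then have q: "q > n" "prime q" by auto
        have "real n \<le> 1 * real q ^ 2"
          using q power_increasing[of 1 2 "real q"] by simp
        then have "real n / real q ^ 2 \<le> 1" using q by (simp add: divide_le_eq)
        have "\<not> real p < real n / real q ^ 2" if "prime p" for p
        proof -
          have "real p \<ge> 1" using prime_gt_0_nat[OF that] by simp
          then show ?thesis using \<open>real n / real q ^ 2 \<le> 1\<close> by linarith
        qed
        then have "{p. prime p \<and> real p < real n / real q ^ 2} = {}" by blast
        then show "?f q = 0" unfolding prime_count_below_def by (simp only: card.empty of_nat_0)
      qed auto
      finally have 1: "(?f has_sum real (PSP n)) ?P" .
      have 2: "((\<lambda>q. 1 / real q ^ 2 * (real n / ln (real n))) has_sum prime_zeta 2 * (real n / ln (real n))) ?P"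
        by (intro has_sum_cmult_left zeta2)
      have 3: "((\<lambda>q. ?f q - 1 / real q ^ 2 * (real n / ln (real n))) has_sum
          (real (PSP n) - prime_zeta 2 * (real n / ln (real n)))) ?P"
        using has_sum_add[OF 1 has_sum_uminusI[OF 2]] by simp
      have 4: "((\<lambda>q. D * (real n / ln (real n) ^ 2) * real q powr (-(3/2))) has_sum D * (real n / ln (real n) ^ 2) * T) ?P"
        unfolding T_def by (intro has_sum_cmult_right has_sum_infsum sum32)
      have "norm (real (PSP n) - prime_zeta 2 * (real n / ln (real n))) \<le> D * (real n / ln (real n) ^ 2) * T"
      proof (rule norm_infsum_le[OF 3 4])
        fix q assume "q \<in> ?P"
        then show "norm (?f q - 1 / real q ^ 2 * (real n / ln (real n))) \<le> D * (real n / ln (real n) ^ 2) * real q powr (-(3/2))"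
          using D(2)[OF elim, of q] by (simp add: prime_gt_0_nat)
      qed
      then show ?case by (simp add: mult_ac)
    qed
  qed
qed

end
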